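(* Let $\mathcal X$ be a Banach space of analytic functions on the open unit disc $\mathbb D$ such that: for every $\lambda\in\mathbb D$ the evaluation map $f\in\mathcal X\mapsto f(\lambda)\in\mathbb C$ is continuous; $zf\in\mathcal X$ for every $f\in\mathcal X$; and the set $\mathcal P$ of polynomials is (contained and) dense in $\mathcal X$. Let $\mathcal A$ be a commutative unital Banach algebra of functions on $\mathbb D$ such that: $\mathcal A\subset\mathfrak M(\mathcal X)$; for every $\lambda\in\mathbb D$ the evaluation map $f\in\mathcal A\mapsto f(\lambda)\in\mathbb C$ is continuous; and there exist constants $C>0$ and $A\ge 1$ such that for every $\delta>0$ and every $f_1,f_2\in\mathcal A$ satisfying $0<\delta\le |f_1|+|f_2|\le 1$ on $\mathbb D$, there exist $g_1,g_2\in\mathcal A$ with $f_1g_1+f_2g_2\equiv 1$ on $\mathbb D$ and $\|g_1\|_{\mathcal A},\|g_2\|_{\mathcal A}\le C/\delta^{A}$. Let $f,g\in\mathcal A$ be such that $|g(z)|\le |f(z)|$ for every $z\in\mathbb D$. Suppose that $g$ is cyclic for the shift $S$ in $\mathcal X$. Then $f$ is cyclic for $S$ in $\mathcal X$.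
   Context: $\mathfrak M(\mathcal X)=\{\varphi\in\mathcal X:\varphi f\in\mathcal X \text{ for all } f\in\mathcal X\}$ is the algebra of multipliers of $\mathcal X$. The algebra $\mathcal A$ carries pointwise operations, its unit is the constant function $1$, and it has its own complete norm $\|\cdot\|_{\mathcal A}$. $S:\mathcal X\to\mathcal X$ is the shift operator $(Sf)(z)=zf(z)$. A function $f\in\mathcal X$ is cyclic for $S$ in $\mathcal X$ if $\{pf:p\in\mathcal P\}$ is dense in $\mathcal X$, where $\mathcal P$ is the set of polynomials. *)

theory Defs
  imports "HOL-Analysis.Analysis" "HOL-Library.Function_Algebras"
begin

abbreviation unit_disc :: "complex set" ("\<D>") where
  "\<D> \<equiv> ball 0 1"

text \<open>
  A function on the disc is represented by the total function that extends it by zero, so that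
  equality on the disc is equality in HOL. The algebraic operations on functions
  are the pointwise ones of \<^theory>\<open>HOL-Library.Function_Algebras\<close>.
\<close>

definition on_disc :: "(complex \<Rightarrow> complex) \<Rightarrow> complex \<Rightarrow> complex" where
  "on_disc f = (\<lambda>z. if z \<in> \<D> then f z else 0)"

text \<open>
  The norm \<open>N\<close> carries no information outside \<open>X\<close>; the distance is made zero there because
  \<^locale>\<open>Metric_space\<close> wants symmetry and nonnegativity on the whole type.
\<close>

definition norm_dist ::
  "(complex \<Rightarrow> complex) set \<Rightarrow> ((complex \<Rightarrow> complex) \<Rightarrow> real) \<Rightarrow>
   (complex \<Rightarrow> complex) \<Rightarrow> (complex \<Rightarrow> complex) \<Rightarrow> real" where
  "norm_dist X N f g = (if f \<in> X \<and> g \<in> X then N (f - g) else 0)"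

definition norm_topology ::
  "(complex \<Rightarrow> complex) set \<Rightarrow> ((complex \<Rightarrow> complex) \<Rightarrow> real) \<Rightarrow> (complex \<Rightarrow> complex) topology" where
  "norm_topology X N = Metric_space.mtopology X (norm_dist X N)"

locale normed_function_space =
  fixes X :: "(complex \<Rightarrow> complex) set" and N :: "(complex \<Rightarrow> complex) \<Rightarrow> real"
  assumes zero_outside: "f \<in> X \<Longrightarrow> z \<notin> \<D> \<Longrightarrow> f z = 0"
    and zero_mem: "0 \<in> X"
    and add_mem: "f \<in> X \<Longrightarrow> g \<in> X \<Longrightarrow> f + g \<in> X"
    and scale_mem: "f \<in> X \<Longrightarrow> (\<lambda>z. c * f z) \<in> X"
    and norm_eq_zero: "f \<in> X \<Longrightarrow> N f = 0 \<longleftrightarrow> f = 0"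
    and norm_triangle: "f \<in> X \<Longrightarrow> g \<in> X \<Longrightarrow> N (f + g) \<le> N f + N g"
    and norm_scale: "f \<in> X \<Longrightarrow> N (\<lambda>z. c * f z) = cmod c * N f"
begin

lemma uminus_mem: "f \<in> X \<Longrightarrow> - f \<in> X"
  using scale_mem[of f "- 1"] by (simp add: fun_Compl_def)

lemma norm_uminus: "f \<in> X \<Longrightarrow> N (- f) = N f"
  using norm_scale[of f "- 1"] by (simp add: fun_Compl_def)

lemma diff_mem: "f \<in> X \<Longrightarrow> g \<in> X \<Longrightarrow> f - g \<in> X"
  using add_mem[of f "- g"] uminus_mem[of g] by simp

lemma norm_nonneg: "f \<in> X \<Longrightarrow> 0 \<le> N f"
  using norm_triangle[of f "- f"] norm_eq_zero[of 0] zero_mem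
  by (simp add: uminus_mem norm_uminus)

sublocale Metric_space X "norm_dist X N"
proof
  show "0 \<le> norm_dist X N f g" for f g
    by (simp add: norm_dist_def norm_nonneg diff_mem)
  show "norm_dist X N f g = norm_dist X N g f" for f g
    using norm_uminus[of "f - g"] by (auto simp: norm_dist_def diff_mem)
  show "norm_dist X N f g = 0 \<longleftrightarrow> f = g" if "f \<in> X" "g \<in> X" for f g
    using that by (simp add: norm_dist_def norm_eq_zero diff_mem)
  show "norm_dist X N f h \<le> norm_dist X N f g + norm_dist X N g h"
    if "f \<in> X" "g \<in> X" "h \<in> X" for f g h
    using that norm_triangle[of "f - g" "g - h"] by (simp add: norm_dist_def diff_mem)
qed

end

locale banach_function_space = normed_function_space +
  assumes complete: "mcomplete"

text \<open>The norm of the unit is not required to be 1.\<close>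

locale banach_function_algebra = banach_function_space A N
  for A :: "(complex \<Rightarrow> complex) set" and N :: "(complex \<Rightarrow> complex) \<Rightarrow> real" +
  assumes unit_mem: "on_disc (\<lambda>z. 1) \<in> A"
    and mult_mem: "f \<in> A \<Longrightarrow> g \<in> A \<Longrightarrow> f * g \<in> A"
    and norm_mult: "f \<in> A \<Longrightarrow> g \<in> A \<Longrightarrow> N (f * g) \<le> N f * N g"

definition polynomials :: "(complex \<Rightarrow> complex) set" where
  "polynomials = {on_disc (poly p) | p. True}"

definition shift_operator :: "(complex \<Rightarrow> complex) \<Rightarrow> complex \<Rightarrow> complex" where
  "shift_operator f = (\<lambda>z. z * f z)"

definition multipliers :: "(complex \<Rightarrow> complex) set \<Rightarrow> (complex \<Rightarrow> complex) set" where
  "multipliers X = {\<phi> \<in> X. \<forall>f\<in>X. \<phi> * f \<in> X}"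

definition dense_subset ::
  "(complex \<Rightarrow> complex) set \<Rightarrow> ((complex \<Rightarrow> complex) \<Rightarrow> real) \<Rightarrow> (complex \<Rightarrow> complex) set \<Rightarrow> bool" where
  "dense_subset X N D \<longleftrightarrow> D \<subseteq> X \<and> norm_topology X N closure_of D = X"

definition shift_cyclic ::
  "(complex \<Rightarrow> complex) set \<Rightarrow> ((complex \<Rightarrow> complex) \<Rightarrow> real) \<Rightarrow> (complex \<Rightarrow> complex) \<Rightarrow> bool" where
  "shift_cyclic X N f \<longleftrightarrow> f \<in> X \<and> dense_subset X N {p * f | p. p \<in> polynomials}"

end

theory Submission
  imports Defs
begin

text \<open>
  For every \<open>\<lambda>\<close>, \<open>\<bar>\<lambda>\<bar> \<le> \<bar>f\<bar> + \<bar>\<lambda> - g\<bar>\<close> on the disc, so the corona hypothesis inverts \<open>\<lambda> - g\<close> modulo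
  \<open>f A\<close>, and the inverse grows at most polynomially in \<open>1 / \<bar>\<lambda>\<bar>\<close>. In the quotient of \<open>A\<close> by the closure of
  \<open>f A\<close>, the resolvent of \<open>g\<close> thus has at most a pole at \<open>0\<close> and no other singularity, so some power
  \<open>g\<^sup>m\<close> lies in the closure of \<open>f A\<close>. Multiplications are bounded operators by the closed graph theorem.
  So \<open>g\<^sup>m\<close> is cyclic together with \<open>g\<close>, and the closed invariant subspace generated by \<open>f\<close>, which contains \<open>g\<^sup>m\<close>,
  is the whole space. The step from the pole to \<open>g\<^sup>m\<close> uses averages over roots of unity in
  place of contour integrals (Rickart's proof of the spectral radius formula), with the distance
  to \<open>f A\<close> as a seminorm on \<open>A\<close> in place of the quotient norm.
\<close>

subsection \<open>Nilpotence from resolvent growth\<close>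

definition unity_root :: "nat \<Rightarrow> nat \<Rightarrow> complex" where
  "unity_root n k = exp (2 * of_real pi * \<i> * of_nat k / of_nat n)"

lemma cmod_unity_root [simp]: "cmod (unity_root n k) = 1"
  by (simp add: unity_root_def norm_exp_eq_Re)

text \<open>Exchanging the index of the root with the exponent turns a sum over all roots into a
  geometric series in one fixed root.\<close>

lemma unity_root_power: "unity_root n k ^ p = unity_root n p ^ k"
  by (simp add: unity_root_def exp_of_nat_mult [symmetric] field_simps)

lemma unity_root_eq_1_iff:
  assumes "n > 0"
  shows "unity_root n p = 1 \<longleftrightarrow> n dvd p"
  using complex_root_unity_eq_1[of n p] assms by (simp add: unity_root_def)

text \<open>A geometric series whose ratio \<open>unity_root n p\<close> is an n-th root of unity,
  equal to 1 exactly when n divides p.\<close>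

lemma sum_unity_root_power:
  assumes "n > 0"
  shows "(\<Sum>k<n. unity_root n k ^ p) = (if n dvd p then of_nat n else 0)"
proof (cases "n dvd p")
  case True
  with unity_root_eq_1_iff[OF assms, of p] show ?thesis
    by (simp add: unity_root_power[of n _ p])
next
  case False
  have "unity_root n p ^ n = 1"
    using unity_root_eq_1_iff[OF assms, of n] by (simp add: unity_root_power[of n p n])
  then show ?thesis
    using False unity_root_eq_1_iff[OF assms, of p] geometric_sum[of "unity_root n p" n]
    by (simp add: unity_root_power[of n _ p])
qed

text \<open>Scalars enter through \<open>K\<close> because the type is only a ring, and
  \<open>B\<close> is a carrier inside that ring. Since \<open>q\<close> may vanish on nonzero
  elements, computing in a quotient algebra becomes computing modulo the kernel of
  \<open>q\<close>.\<close>

locale complex_algebra_seminorm =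
  fixes B :: "'a::comm_ring_1 set" and K :: "complex \<Rightarrow> 'a" and q :: "'a \<Rightarrow> real"
  assumes K_mem: "K c \<in> B"
    and K_add: "K (c + d) = K c + K d"
    and K_mult: "K (c * d) = K c * K d"
    and K_1: "K 1 = 1"
    and add_mem: "u \<in> B \<Longrightarrow> v \<in> B \<Longrightarrow> u + v \<in> B"
    and mult_mem: "u \<in> B \<Longrightarrow> v \<in> B \<Longrightarrow> u * v \<in> B"
    and q_add: "u \<in> B \<Longrightarrow> v \<in> B \<Longrightarrow> q (u + v) \<le> q u + q v"
    and q_mult: "u \<in> B \<Longrightarrow> v \<in> B \<Longrightarrow> q (u * v) \<le> q u * q v"
    and q_scale: "u \<in> B \<Longrightarrow> q (K c * u) = cmod c * q u"
begin

lemma K_0: "K 0 = 0"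
  using K_add[of 0 0] by simp

lemma K_uminus: "K (- c) = - K c"
  using K_add[of c "- c"] K_0 by (metis add.right_inverse add_eq_0_iff)

lemma K_diff: "K (c - d) = K c - K d"
  using K_add[of c "- d"] by (simp add: K_uminus)

lemma K_power: "K (c ^ n) = K c ^ n"
  by (induction n) (simp_all add: K_1 K_mult)

lemma K_sum: "K (sum f I) = (\<Sum>i\<in>I. K (f i))"
  by (induction I rule: infinite_finite_induct) (simp_all add: K_0 K_add)

lemma one_mem: "1 \<in> B"
  using K_mem[of 1] by (simp add: K_1)

lemma zero_mem: "0 \<in> B"
  using K_mem[of 0] by (simp add: K_0)

lemma uminus_mem: "u \<in> B \<Longrightarrow> - u \<in> B"
  using mult_mem[OF K_mem[of "- 1"], of u] by (simp add: K_uminus K_1)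

lemma diff_mem: "u \<in> B \<Longrightarrow> v \<in> B \<Longrightarrow> u - v \<in> B"
  using add_mem[of u "- v"] uminus_mem[of v] by simp

lemma power_mem: "u \<in> B \<Longrightarrow> u ^ n \<in> B"
  by (induction n) (simp_all add: one_mem mult_mem)

lemma sum_mem: "(\<And>i. i \<in> I \<Longrightarrow> f i \<in> B) \<Longrightarrow> sum f I \<in> B"
  by (induction I rule: infinite_finite_induct) (simp_all add: zero_mem add_mem)

lemmas mem = K_mem add_mem mult_mem one_mem zero_mem uminus_mem diff_mem power_mem sum_mem

lemma q_0: "q 0 = 0"
  using q_scale[of 0 0] by (simp add: zero_mem K_0)

lemma q_uminus: "u \<in> B \<Longrightarrow> q (- u) = q u"
  using q_scale[of u "- 1"] by (simp add: K_uminus K_1)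

lemma q_nonneg: "u \<in> B \<Longrightarrow> 0 \<le> q u"
  using q_add[of u "- u"] by (simp add: q_0 q_uminus uminus_mem)

lemma q_diff: "u \<in> B \<Longrightarrow> v \<in> B \<Longrightarrow> q (u - v) \<le> q u + q v"
  using q_add[of u "- v"] by (simp add: q_uminus uminus_mem)

lemma q_K: "q (K c) = cmod c * q 1"
  using q_scale[of 1 c] by (simp add: one_mem)

text \<open>Exponents start at 1 because \<open>q 1\<close> may exceed 1.\<close>

lemma q_power_Suc: "u \<in> B \<Longrightarrow> q (u ^ Suc n) \<le> q u ^ Suc n"
proof (induction n)
  case (Suc n)
  have "q (u ^ Suc (Suc n)) \<le> q u * q (u ^ Suc n)"
    using q_mult[of u "u ^ Suc n"] Suc.prems by (simp add: mem)
  also have "\<dots> \<le> q u * q u ^ Suc n"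
    using Suc by (intro mult_left_mono q_nonneg) auto
  finally show ?case by simp
qed simp

lemma q_eqI:
  assumes "u \<in> B" "v \<in> B" "q (u - v) = 0"
  shows "q u = q v"
  using q_add[of "u - v" v] q_diff[of u "u - v"] assms by (simp add: mem)

text \<open>An ideal of \<open>B\<close>; an equation in the quotient algebra is expressed by a
  difference lying in this set.\<close>

definition null :: "'a set" where
  "null = {u \<in> B. q u = 0}"

lemma null_add: "u \<in> null \<Longrightarrow> v \<in> null \<Longrightarrow> u + v \<in> null"
  using q_add[of u v] q_nonneg[of "u + v"] by (auto simp: null_def mem)

lemma null_mult: "u \<in> null \<Longrightarrow> v \<in> B \<Longrightarrow> v * u \<in> null"
  using q_mult[of v u] q_nonneg[of "v * u"] by (auto simp: null_def mem)

lemma null_diff: "u \<in> null \<Longrightarrow> v \<in> null \<Longrightarrow> u - v \<in> null"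
  using q_diff[of u v] q_nonneg[of "u - v"] by (auto simp: null_def mem)

lemma null_sum: "(\<And>i. i \<in> I \<Longrightarrow> f i \<in> null) \<Longrightarrow> sum f I \<in> null"
  by (induction I rule: infinite_finite_induct)
    (simp_all add: null_add, simp_all add: null_def q_0 zero_mem)

section \<open>Averages of resolvents over points of a circle\<close>

definition average :: "nat \<Rightarrow> (nat \<Rightarrow> 'a) \<Rightarrow> 'a" where
  "average n F = K (1 / of_nat n) * (\<Sum>k<n. F k)"

lemma average_mem: "(\<And>k. F k \<in> B) \<Longrightarrow> average n F \<in> B"
  by (simp add: average_def mem)

lemma q_average_le:
  assumes "n > 0" "\<And>k. F k \<in> B" "\<And>k. q (F k) \<le> M"
  shows "q (average n F) \<le> M"
proof -
  have "q (\<Sum>k<m. F k) \<le> of_nat m * M" for m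
  proof (induction m)
    case (Suc m)
    then show ?case
      using q_add[of "\<Sum>k<m. F k" "F m"] assms(2) assms(3)[of m]
      by (simp add: mem algebra_simps)
  qed (simp add: q_0)
  from this[of n] show ?thesis
    using assms(1,2) q_scale[of "\<Sum>k<n. F k" "1 / of_nat n"]
    by (simp add: average_def sum_mem norm_divide divide_le_eq mult.commute[of M])
qed

lemma average_null: "(\<And>k. F k \<in> null) \<Longrightarrow> average n F \<in> null"
  unfolding average_def by (intro null_mult null_sum mem)

lemma average_diff: "average n F - average n G = average n (\<lambda>k. F k - G k)"
  by (simp add: average_def sum_subtractf right_diff_distrib)

text \<open>
  Partial fractions: modulo null elements, averaging \<open>\<lambda>\<^sup>N\<^sup>+\<^sup>1 (\<lambda> - x)\<^sup>-\<^sup>1\<close> over the \<open>n\<close>-th roots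
  \<open>\<lambda>\<close> of \<open>r\<^sup>n\<close> gives \<open>x\<^sup>N (1 - (x / r)\<^sup>n)\<^sup>-\<^sup>1\<close>.
\<close>

lemma average_resolvent:
  fixes r :: real
  assumes "N < n" "x \<in> B" "\<And>k. b k \<in> B"
    and res: "\<And>k. (K (of_real r * unity_root n k) - x) * b k - 1 \<in> null"
  shows "average n (\<lambda>k. K ((of_real r * unity_root n k) ^ Suc N) * b k)
           * (K (of_real r ^ n) - x ^ n) - x ^ N * K (of_real r ^ n) \<in> null"
proof -
  define l where "l k = of_real r * unity_root n k" for k
  \<comment> \<open>The error by which \<open>b k\<close> fails to invert
    \<open>K (l k) - x\<close>; it is null by \<open>res\<close>.\<close>
  define c where "c k = (K (l k) - x) * b k - 1" for k
  define P where "P k = (\<Sum>i<n. x ^ (n - Suc i) * K (l k) ^ i)" for k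
  have n: "n > 0" using assms(1) by simp
  have l_n: "l k ^ n = of_real r ^ n" for k
    using unity_root_eq_1_iff[OF n, of n] unity_root_power[of n k n]
    by (simp add: l_def power_mult_distrib)
  have step: "K (l k ^ Suc N) * b k * (K (of_real r ^ n) - x ^ n)
      = K (l k ^ Suc N) * P k + K (l k ^ Suc N) * P k * c k" for k
  proof -
    have "K (of_real r ^ n) - x ^ n = (K (l k) - x) * P k"
      by (simp only: l_n[of k, symmetric] K_power power_diff_sumr2 P_def)
    then have "K (l k ^ Suc N) * b k * (K (of_real r ^ n) - x ^ n)
        = K (l k ^ Suc N) * P k * ((K (l k) - x) * b k)"
      by (simp only: ac_simps)
    also have "(K (l k) - x) * b k = 1 + c k"
      by (simp add: c_def)
    finally show ?thesis
      by (simp only: distrib_left mult_1_right)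
  qed
  have sum_l: "(\<Sum>k<n. l k ^ p) = (if n dvd p then of_nat n * of_real r ^ p else 0)" for p
    using sum_unity_root_power[OF n, of p]
    by (auto simp: l_def power_mult_distrib simp flip: sum_distrib_left)
  \<comment> \<open>Since 0 < Suc N + i < 2 n, the only possible multiple of n is n itself. So one
    term of the double sum survives, and its power of x is n - Suc i = N.\<close>
  have dvd: "n dvd Suc N + i \<longleftrightarrow> i = n - Suc N" if "i < n" for i
  proof
    assume "n dvd Suc N + i"
    then obtain j where j: "Suc N + i = n * j" by auto
    have "j \<noteq> 0" using j by (cases j) auto
    moreover have "j < 2"
    proof (rule ccontr)
      assume "\<not> j < 2"
      then have "n * 2 \<le> n * j" by simp
      then show False using j that assms(1) by linarith
    qed
    ultimately show "i = n - Suc N" using j by (cases j) auto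
  qed (use assms(1) in auto)
  have "(\<Sum>k<n. K (l k ^ Suc N) * P k) = (\<Sum>k<n. \<Sum>i<n. x ^ (n - Suc i) * K (l k ^ (Suc N + i)))"
    by (simp add: P_def sum_distrib_left K_power K_mult power_add ac_simps)
  also have "\<dots> = (\<Sum>i<n. x ^ (n - Suc i) * K (\<Sum>k<n. l k ^ (Suc N + i)))"
    by (subst sum.swap) (simp add: K_sum sum_distrib_left)
  also have "\<dots> = (\<Sum>i<n. if i = n - Suc N then x ^ N * K (of_nat n * of_real r ^ n) else 0)"
    using assms(1) by (intro sum.cong refl) (simp only: lessThan_iff sum_l dvd, auto simp: K_0)
  also have "\<dots> = x ^ N * K (of_nat n * of_real r ^ n)"
    using n by (subst sum.delta) auto
  finally have main: "average n (\<lambda>k. K (l k ^ Suc N) * P k) = x ^ N * K (of_real r ^ n)"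
    using n by (simp add: average_def mult.left_commute[of _ "x ^ N"] flip: K_mult)
  have "average n (\<lambda>k. K (l k ^ Suc N) * b k) * (K (of_real r ^ n) - x ^ n)
      = average n (\<lambda>k. K (l k ^ Suc N) * P k) + average n (\<lambda>k. K (l k ^ Suc N) * P k * c k)"
    by (simp only: average_def mult.assoc[of "K (1 / of_nat n)"] sum_distrib_right step
        sum.distrib distrib_left)
  moreover have "average n (\<lambda>k. K (l k ^ Suc N) * P k * c k) \<in> null"
    using res by (intro average_null null_mult) (auto simp: c_def l_def P_def intro!: mem \<open>x \<in> B\<close>)
  ultimately show ?thesis
    using main by (simp add: l_def)
qed

text \<open>The resolvent identity for z (z - x)^-1. Weighting the two errors of inversion by
  \<open>K m * b'\<close> and \<open>K l * b\<close> gives exactly the defect of the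
  identity.\<close>

lemma resolvent_diff:
  assumes "x \<in> B" "b \<in> B" "b' \<in> B"
    and "(K l - x) * b - 1 \<in> null" "(K m - x) * b' - 1 \<in> null"
  shows "(K l * b - K m * b') - K (m - l) * (x * (b * b')) \<in> null"
proof -
  have "(K l * b - K m * b') - K (m - l) * (x * (b * b'))
     = K m * b' * ((K l - x) * b - 1) - K l * b * ((K m - x) * b' - 1)"
    by (simp add: K_diff algebra_simps)
  also have "\<dots> \<in> null"
    by (intro null_diff null_mult mult_mem K_mem assms)
  finally show ?thesis .
qed


text \<open>The case \<open>N = 0\<close> of \<open>average_resolvent\<close>, divided by r^n: the
  average inverts 1 - (x / r)^n modulo null elements.\<close>

lemma average_inverse:
  fixes r :: real
  assumes "n > 0" "r > 0" "x \<in> B" "\<And>k. b k \<in> B"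
    and "\<And>k. (K (of_real r * unity_root n k) - x) * b k - 1 \<in> null"
  shows "average n (\<lambda>k. K (of_real r * unity_root n k) * b k)
           * (1 - K (of_real (1 / r ^ n)) * x ^ n) - 1 \<in> null"
proof -
  let ?z = "average n (\<lambda>k. K (of_real r * unity_root n k) * b k)"
  have inv: "K (of_real (1 / r ^ n)) * K (of_real r ^ n) = 1"
    using assms(2) by (simp add: K_1 flip: K_mult)
  have "K (of_real (1 / r ^ n)) * (?z * (K (of_real r ^ n) - x ^ n) - K (of_real r ^ n)) \<in> null"
    using average_resolvent[of 0 n x b r] assms by (intro null_mult K_mem) simp
  also have "K (of_real (1 / r ^ n)) * (?z * (K (of_real r ^ n) - x ^ n) - K (of_real r ^ n))
    = ?z * (K (of_real (1 / r ^ n)) * K (of_real r ^ n) - K (of_real (1 / r ^ n)) * x ^ n)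
        - K (of_real (1 / r ^ n)) * K (of_real r ^ n)"
    by (simp only: right_diff_distrib) (simp only: ac_simps)
  finally show ?thesis by (simp only: inv)
qed

section \<open>Growth rates of powers, a quantitative form of the spectral radius\<close>

definition growth_le :: "'a \<Rightarrow> real \<Rightarrow> bool" where
  "growth_le x s \<longleftrightarrow> (\<exists>M. \<forall>\<^sub>F n in sequentially. q (x ^ n) \<le> M * s ^ n)"

lemma growth_le_imp_tendsto:
  assumes "growth_le x s" "x \<in> B" "0 < s" "s < r"
  shows "(\<lambda>n. q (x ^ n) / r ^ n) \<longlonglongrightarrow> 0"
proof -
  obtain M where M: "\<forall>\<^sub>F n in sequentially. q (x ^ n) \<le> M * s ^ n"
    using assms(1) by (auto simp: growth_le_def)
  have "(\<lambda>n. M * (s / r) ^ n) \<longlonglongrightarrow> M * 0"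
    using assms by (intro tendsto_mult tendsto_const LIMSEQ_power_zero) auto
  then have lim: "(\<lambda>n. M * (s / r) ^ n) \<longlonglongrightarrow> 0" by simp
  show ?thesis
  proof (rule tendsto_sandwich[OF _ _ tendsto_const lim])
    show "\<forall>\<^sub>F n in sequentially. 0 \<le> q (x ^ n) / r ^ n"
      using assms by (simp add: q_nonneg mem)
    show "\<forall>\<^sub>F n in sequentially. q (x ^ n) / r ^ n \<le> M * (s / r) ^ n"
      using M by eventually_elim (use assms in \<open>simp add: power_divide divide_right_mono\<close>)
  qed
qed

text \<open>
  The averages \<open>(1 - (x / r)\<^sup>n)\<^sup>-\<^sup>1\<close> depend on \<open>r\<close> equicontinuously in \<open>n\<close>, by the resolvent identity.
  They tend to \<open>1\<close> at \<open>r = m\<close>, so they stay within \<open>1 / 2\<close> of \<open>1\<close> at nearby \<open>r = l\<close>, which bounds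
  \<open>(x / l)\<^sup>n\<close>.
\<close>

lemma growth_le_step:
  fixes l m s M :: real
  assumes x: "x \<in> B"
    and b: "\<And>z. l \<le> cmod z \<Longrightarrow> cmod z \<le> m \<Longrightarrow> b z \<in> B \<and> (K z - x) * b z - 1 \<in> null \<and> q (b z) \<le> M"
    and "0 < l" "l \<le> m" "0 < s" "s < m" "growth_le x s" "(m - l) * (q x * M\<^sup>2) \<le> 1 / 4"
  shows "growth_le x l"
proof -
  define z where "z r n = average n (\<lambda>k. K (of_real r * unity_root n k) * b (of_real r * unity_root n k))"
    for r n
  have b': "b (of_real r * unity_root n k) \<in> B"
      "(K (of_real r * unity_root n k) - x) * b (of_real r * unity_root n k) - 1 \<in> null"
      "q (b (of_real r * unity_root n k)) \<le> M" if "l \<le> r" "r \<le> m" for r n k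
    using b[of "of_real r * unity_root n k"] that \<open>0 < l\<close> by (auto simp: norm_mult)
  have M: "M \<ge> 0"
    using b'(1,3)[of l 0 0] \<open>l \<le> m\<close> q_nonneg order_trans by blast
  have z_mem: "z r n \<in> B" if "l \<le> r" "r \<le> m" for r n
    unfolding z_def by (intro average_mem mult_mem K_mem b' that)
  \<comment> \<open>This is (x / r)^n, so \<open>z r n\<close> inverts \<open>1 - v r n\<close>
    modulo null elements by \<open>average_inverse\<close>.\<close>
  define v where "v r n = K (of_real (1 / r ^ n)) * x ^ n" for r n
  have v_mem: "v r n \<in> B" for r n
    by (simp add: v_def mem x)
  have q_v: "q (v r n) = q (x ^ n) / r ^ n" if "r > 0" for r n
    using q_scale[of "x ^ n" "of_real (1 / r ^ n)"] that
    by (simp add: v_def power_mem x norm_divide norm_power)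
  have inv: "z r n * (1 - v r n) - 1 \<in> null" if "l \<le> r" "r \<le> m" "n > 0" for r n
    unfolding z_def v_def using that \<open>0 < l\<close> by (intro average_inverse x b') auto
  \<comment> \<open>Modulo null elements each term of the difference is x times both inverses times
    a scalar of modulus m - l. Averaging preserves the resulting bound, so it is uniform in
    n.\<close>
  have near: "q (z l n - z m n) \<le> 1 / 4" if "n > 0" for n
  proof -
    have "q (K (of_real l * unity_root n k) * b (of_real l * unity_root n k)
        - K (of_real m * unity_root n k) * b (of_real m * unity_root n k)) \<le> 1 / 4" (is "q (?u - ?v) \<le> _") for k
    proof -
      let ?b = "b (of_real l * unity_root n k)" and ?b' = "b (of_real m * unity_root n k)"
      let ?c = "of_real m * unity_root n k - of_real l * unity_root n k"
      have bb: "?b \<in> B" "?b' \<in> B" "q ?b \<le> M" "q ?b' \<le> M"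
        using b' \<open>l \<le> m\<close> by auto
      have "(?u - ?v) - K ?c * (x * (?b * ?b')) \<in> null"
        using b' \<open>l \<le> m\<close> by (intro resolvent_diff x) auto
      then have "q (?u - ?v) = q (K ?c * (x * (?b * ?b')))"
        by (intro q_eqI mem x bb) (simp add: null_def)
      also have "\<dots> = cmod ?c * q (x * (?b * ?b'))"
        by (intro q_scale mem x bb)
      also have "?c = of_real (m - l) * unity_root n k"
        by (simp add: algebra_simps)
      also have "cmod \<dots> = m - l"
        using \<open>l \<le> m\<close> by (simp only: norm_mult cmod_unity_root norm_of_real) simp
      also have "q (x * (?b * ?b')) \<le> q x * q (?b * ?b')"
        by (intro q_mult x mult_mem bb)
      also have "q (?b * ?b') \<le> q ?b * q ?b'"
        by (intro q_mult bb)
      also have "\<dots> \<le> M * M"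
        by (intro mult_mono bb M q_nonneg)
      finally show ?thesis
        using assms(8) \<open>l \<le> m\<close> by (simp add: mult_left_mono q_nonneg x power2_eq_square)
    qed
    then show ?thesis
      unfolding z_def average_diff using b' \<open>l \<le> m\<close> that
      by (intro q_average_le mem) auto
  qed
  \<comment> \<open>Modulo null elements \<open>z m n - 1\<close> equals
    \<open>z m n * v m n\<close>, and \<open>q (z m n)\<close> is at most m M. This product bounds
    the distance of \<open>z m n\<close> from 1.\<close>
  have "(\<lambda>n. m * M * (q (x ^ n) / m ^ n)) \<longlonglongrightarrow> m * M * 0"
    using assms by (intro tendsto_mult tendsto_const growth_le_imp_tendsto[of x s])
  then have "\<forall>\<^sub>F n in sequentially. m * M * (q (x ^ n) / m ^ n) < 1 / 4"
    by (intro order_tendstoD) auto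
  then have "\<forall>\<^sub>F n in sequentially. q (x ^ n) \<le> (3 * q 1) * l ^ n"
    using eventually_gt_at_top[of 0]
  proof eventually_elim
    case (elim n)
    have q_z: "q (z m n) \<le> m * M"
      unfolding z_def
    proof (rule q_average_le)
      show "K (of_real m * unity_root n k) * b (of_real m * unity_root n k) \<in> B" for k
        using b' \<open>l \<le> m\<close> by (intro mem) auto
      show "q (K (of_real m * unity_root n k) * b (of_real m * unity_root n k)) \<le> m * M" for k
        using b'[of m n k] \<open>l \<le> m\<close> \<open>0 < l\<close> by (simp add: q_scale norm_mult mult_left_mono)
    qed fact
    have "q (z m n - 1) = q (z m n * v m n)"
      using inv[of m n] \<open>l \<le> m\<close> elim
      by (intro q_eqI mem v_mem z_mem) (auto simp: null_def algebra_simps)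
    also have "\<dots> \<le> q (z m n) * q (v m n)"
      using \<open>l \<le> m\<close> by (intro q_mult v_mem z_mem) auto
    also have "\<dots> \<le> m * M * q (v m n)"
      by (intro mult_right_mono q_z q_nonneg v_mem)
    also have "\<dots> \<le> 1 / 4"
      using elim \<open>0 < l\<close> \<open>l \<le> m\<close> by (simp add: q_v)
    finally have "q (z m n - 1) \<le> 1 / 4" .
    moreover have "q (z l n - 1) \<le> q (z l n - z m n) + q (z m n - 1)"
      using q_add[of "z l n - z m n" "z m n - 1"] z_mem \<open>l \<le> m\<close> by (simp add: mem)
    ultimately have z1: "q (z l n - 1) \<le> 1 / 2"
      using near[of n] elim by linarith
    have mems: "z l n \<in> B" "1 - v l n \<in> B" "z l n - 1 \<in> B"
      using z_mem[of l n] \<open>l \<le> m\<close> by (simp_all add: mem v_mem)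
    \<comment> \<open>Absorption: the first summand is 1 modulo null elements, and the second is at
      most half of the left-hand side.\<close>
    have "q (1 - v l n) = q (z l n * (1 - v l n) - (z l n - 1) * (1 - v l n))"
      by (simp add: algebra_simps)
    also have "\<dots> \<le> q (z l n * (1 - v l n)) + q ((z l n - 1) * (1 - v l n))"
      by (intro q_diff mult_mem mems)
    also have "q (z l n * (1 - v l n)) = q 1"
      using inv[of l n] \<open>l \<le> m\<close> elim by (intro q_eqI mult_mem mems one_mem) (auto simp: null_def)
    also have "q ((z l n - 1) * (1 - v l n)) \<le> q (z l n - 1) * q (1 - v l n)"
      by (intro q_mult mems)
    also have "\<dots> \<le> 1 / 2 * q (1 - v l n)"
      by (intro mult_right_mono z1 q_nonneg mems)
    finally have "q (1 - v l n) \<le> 2 * q 1"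
      by simp
    then have "q (v l n) \<le> 3 * q 1"
      using q_diff[of 1 "1 - v l n"] mems by (simp add: one_mem)
    then show ?case
      using \<open>0 < l\<close> by (simp add: q_v divide_le_eq)
  qed
  then show ?thesis
    by (auto simp: growth_le_def)
qed

text \<open>Submultiplicativity gives a growth rate below L. The uniform bound M on the annulus
  fixes a step length for \<open>growth_le_step\<close>, so finitely many steps lead down to
  r.\<close>

lemma growth_le_of_resolvent:
  fixes r M L :: real
  assumes x: "x \<in> B"
    and b: "\<And>z. r \<le> cmod z \<Longrightarrow> cmod z \<le> L \<Longrightarrow> b z \<in> B \<and> (K z - x) * b z - 1 \<in> null \<and> q (b z) \<le> M"
    and r: "0 < r" "r < L" "q x < L"
  shows "growth_le x r"
proof -
  \<comment> \<open>The starting rate: at least \<open>q x\<close>, so that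
    \<open>q_power_Suc\<close> applies, and below L, so that there is room for a larger
    circle.\<close>
  define s where "s = max r ((q x + L) / 2)"
  have s: "r \<le> s" "q x \<le> s" "s < L"
    using r by (auto simp: s_def le_max_iff_disj)
  have "q (x ^ n) \<le> 1 * s ^ n" if "n > 0" for n
  proof -
    have "q (x ^ n) \<le> q x ^ n"
      using q_power_Suc[OF x, of "n - 1"] that by simp
    also have "\<dots> \<le> s ^ n"
      by (intro power_mono s q_nonneg x)
    finally show ?thesis by simp
  qed
  then have "growth_le x s"
    unfolding growth_le_def by (intro exI[of _ 1] eventually_mono[OF eventually_gt_at_top[of 0]])
  \<comment> \<open>The first bound keeps the outer radius t + e within L. The second makes the
    passage from radius t + e to t - e, of length 2 e, small enough for
    \<open>growth_le_step\<close>; the summand 1 keeps the denominator positive.\<close>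
  define e where "e = min (L - s) (1 / (8 * (q x * M\<^sup>2 + 1)))"
  have pos: "q x * M\<^sup>2 \<ge> 0"
    by (simp add: q_nonneg x)
  then have "e > 0"
    using s by (simp add: e_def)
  have "8 * (e * (q x * M\<^sup>2 + 1)) \<le> 1"
  proof -
    have "e \<le> 1 / (8 * (q x * M\<^sup>2 + 1))" by (simp add: e_def)
    then show ?thesis using pos by (simp add: field_simps)
  qed
  then have e: "2 * e * (q x * M\<^sup>2) \<le> 1 / 4"
    using \<open>e > 0\<close> by (simp add: algebra_simps)
  have "growth_le x (max r (s - of_nat k * e))" for k
  proof (induction k)
    case 0
    then show ?case using \<open>growth_le x s\<close> s by simp
  next
    case (Suc k)
    define t where "t = max r (s - of_nat k * e)"
    have t: "r \<le> t" "t \<le> s"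
      using s \<open>e > 0\<close> by (auto simp: t_def)
    have l: "max r (s - of_nat (Suc k) * e) = max r (t - e)"
      using \<open>e > 0\<close> by (auto simp: t_def algebra_simps max_def)
    have "(t + e - max r (t - e)) * (q x * M\<^sup>2) \<le> 2 * e * (q x * M\<^sup>2)"
      by (intro mult_right_mono pos) auto
    with e have small: "(t + e - max r (t - e)) * (q x * M\<^sup>2) \<le> 1 / 4"
      by linarith
    have "t + e \<le> L"
      using t by (simp add: e_def min_def split: if_splits)
    show ?case
      unfolding l
    proof (rule growth_le_step[OF x _ _ _ _ _ _ small])
      show "b z \<in> B \<and> (K z - x) * b z - 1 \<in> null \<and> q (b z) \<le> M"
        if "max r (t - e) \<le> cmod z" "cmod z \<le> t + e" for z
        using that \<open>t + e \<le> L\<close> by (intro b) auto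
      show "growth_le x t"
        using Suc.IH by (simp add: t_def)
    qed (use t r \<open>e > 0\<close> in auto)
  qed
  moreover obtain k where "s - r \<le> of_nat k * e"
    using ex_less_of_nat_mult[of e "s - r"] \<open>e > 0\<close> by (auto intro: less_imp_le)
  moreover from this have "max r (s - of_nat k * e) = r"
    by simp
  ultimately show ?thesis
    by metis
qed

text \<open>In the Laurent series of the resolvent at 0, x^m is the coefficient of z^-(m+1), which
  vanishes if the pole has order at most m. Averaging over a circle of radius r extracts it with an
  error of order r, and r tends to 0.\<close>

theorem power_null_of_resolvent_growth:
  fixes C L :: real
  assumes x: "x \<in> B" and L: "q x < L"
    and res: "\<And>z. 0 < cmod z \<Longrightarrow> cmod z \<le> L \<Longrightarrow>
      \<exists>b\<in>B. (K z - x) * b - 1 \<in> null \<and> q b \<le> C / cmod z ^ m"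
  shows "x ^ m \<in> null"
proof -
  obtain b where b: "b z \<in> B" "(K z - x) * b z - 1 \<in> null" "q (b z) \<le> C / cmod z ^ m"
    if "0 < cmod z" "cmod z \<le> L" for z
    using res by metis
  have "L > 0" using L q_nonneg[OF x] by simp
  then have "q (b (of_real L)) \<le> C / L ^ m" "b (of_real L) \<in> B"
    using b[of "of_real L"] by auto
  then have "C \<ge> 0"
    using \<open>L > 0\<close> q_nonneg[of "b (of_real L)"]
    by (smt (verit) divide_neg_pos zero_less_power)
  have small: "q (x ^ m) \<le> r * (C * (q 1 + 1))" if r: "0 < r" "r < L" for r
  proof -
    \<comment> \<open>A rate strictly below r makes (x / r)^n tend to 0. On the annulus from r / 2
      to L the resolvent is bounded by its bound at the inner radius.\<close>
    have "growth_le x (r / 2)"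
    proof (rule growth_le_of_resolvent[OF x])
      fix z assume z: "r / 2 \<le> cmod z" "cmod z \<le> L"
      have "C / cmod z ^ m \<le> C / (r / 2) ^ m"
        using z r \<open>C \<ge> 0\<close> by (intro divide_left_mono power_mono mult_pos_pos zero_less_power) auto
      moreover have "0 < cmod z" using z r by linarith
      ultimately show "b z \<in> B \<and> (K z - x) * b z - 1 \<in> null \<and> q (b z) \<le> C / (r / 2) ^ m"
        using b[of z] z(2) order_trans by blast
    qed (use r L in auto)
    then have "(\<lambda>n. q (x ^ n) / r ^ n) \<longlonglongrightarrow> 0"
      using r by (intro growth_le_imp_tendsto[of x "r / 2"] x) auto
    then have "\<forall>\<^sub>F n in sequentially. q (x ^ n) / r ^ n < 1"
      by (intro order_tendstoD) auto
    then have "\<forall>\<^sub>F n in sequentially. q (x ^ n) / r ^ n < 1 \<and> m < n"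
      using eventually_gt_at_top[of m] by (rule eventually_conj)
    then obtain n where n: "q (x ^ n) / r ^ n < 1" "m < n"
      by (auto simp: eventually_sequentially)
    define w where "w k = of_real r * unity_root n k" for k
    define y where "y = average n (\<lambda>k. K (w k ^ Suc m) * b (w k))"
    have w: "cmod (w k) = r" for k
      using r by (simp add: w_def norm_mult)
    have bw: "b (w k) \<in> B" "(K (w k) - x) * b (w k) - 1 \<in> null" "q (b (w k)) \<le> C / r ^ m" for k
      using b[of "w k"] r by (simp_all add: w)
    have "y \<in> B"
      unfolding y_def by (intro average_mem mult_mem K_mem bw)
    \<comment> \<open>The factor of modulus r^(m+1) cancels the growth C / r^m and leaves one power
      of r.\<close>
    have "q (K (w k ^ Suc m) * b (w k)) \<le> r * C" for k
    proof -
      have "q (K (w k ^ Suc m) * b (w k)) = r ^ Suc m * q (b (w k))"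
        using q_scale[OF bw(1)] by (simp add: norm_power norm_mult w)
      also have "\<dots> \<le> r ^ Suc m * (C / r ^ m)"
        using r by (intro mult_left_mono bw) auto
      finally show ?thesis using r by simp
    qed
    then have "q y \<le> r * C"
      unfolding y_def using n by (intro q_average_le mult_mem K_mem bw) auto
    have "y * (K (of_real r ^ n) - x ^ n) - x ^ m * K (of_real r ^ n) \<in> null"
      unfolding y_def w_def using bw by (intro average_resolvent n x) (auto simp: w_def)
    then have "q (y * (K (of_real r ^ n) - x ^ n)) = q (x ^ m * K (of_real r ^ n))"
      by (intro q_eqI mem \<open>y \<in> B\<close> x) (auto simp: null_def)
    also have "\<dots> = r ^ n * q (x ^ m)"
      using q_scale[of "x ^ m" "of_real r ^ n"] r by (simp add: mem x mult.commute[of "x ^ m"] norm_power)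
    finally have "r ^ n * q (x ^ m) \<le> q y * q (K (of_real r ^ n) - x ^ n)"
      using q_mult[of y "K (of_real r ^ n) - x ^ n"] \<open>y \<in> B\<close> by (simp add: mem x)
    also have "\<dots> \<le> q y * (r ^ n * q 1 + r ^ n)"
    proof (intro mult_left_mono q_nonneg \<open>y \<in> B\<close>)
      show "q (K (of_real r ^ n) - x ^ n) \<le> r ^ n * q 1 + r ^ n"
        using q_diff[of "K (of_real r ^ n)" "x ^ n"] q_K[of "of_real r ^ n"] n r
        by (simp add: mem x norm_power divide_less_eq)
    qed
    also have "\<dots> \<le> (r * C) * (r ^ n * q 1 + r ^ n)"
      using \<open>q y \<le> r * C\<close> r q_nonneg[OF one_mem] by (intro mult_right_mono) auto
    also have "\<dots> = r ^ n * (r * (C * (q 1 + 1)))"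
      by (simp add: algebra_simps)
    finally show ?thesis
      using r by simp
  qed
  have "((\<lambda>r. r * (C * (q 1 + 1))) \<longlongrightarrow> 0 * (C * (q 1 + 1))) (at_right 0)"
    by (intro tendsto_intros)
  moreover have "\<forall>\<^sub>F r in at_right 0. q (x ^ m) \<le> r * (C * (q 1 + 1))"
    using \<open>L > 0\<close> small by (auto simp: eventually_at_right_field)
  ultimately have "q (x ^ m) \<le> 0"
    using tendsto_lowerbound[of _ 0 "at_right (0::real)"] by simp
  with q_nonneg[of "x ^ m"] x show ?thesis
    by (simp add: null_def mem)
qed

end

subsection \<open>The closed graph theorem\<close>

context normed_function_space
begin

lemma norm_diff_commute: "f \<in> X \<Longrightarrow> g \<in> X \<Longrightarrow> N (f - g) = N (g - f)"
  using norm_uminus[of "f - g"] by (simp add: diff_mem)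

lemma norm_diff_triangle:
  "f \<in> X \<Longrightarrow> g \<in> X \<Longrightarrow> h \<in> X \<Longrightarrow> N (f - h) \<le> N (f - g) + N (g - h)"
  using norm_triangle[of "f - g" "g - h"] by (simp add: diff_mem)

lemma norm_triangle_diff: "f \<in> X \<Longrightarrow> g \<in> X \<Longrightarrow> N (f - g) \<le> N f + N g"
  using norm_triangle[of f "- g"] by (simp add: uminus_mem norm_uminus)

lemma norm_zero [simp]: "N 0 = 0"
  using norm_eq_zero zero_mem by blast

lemma norm_zero_fun [simp]: "N (\<lambda>z. 0) = 0"
  using norm_zero by (simp add: zero_fun_def)

lemma in_norm_ball: "g \<in> mball f r \<longleftrightarrow> f \<in> X \<and> g \<in> X \<and> N (g - f) < r"
  unfolding in_mball using norm_diff_commute[of f g] by (auto simp: norm_dist_def)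

lemma dense_subset_iff:
  "dense_subset X N D \<longleftrightarrow> D \<subseteq> X \<and> (\<forall>h\<in>X. \<forall>e>0. \<exists>d\<in>D. N (d - h) < e)"
proof -
  have "mtopology closure_of D = {h \<in> X. \<forall>e>0. \<exists>d\<in>D. d \<in> X \<and> N (d - h) < e}"
    unfolding metric_closure_of in_norm_ball by auto
  then have *: "dense_subset X N D \<longleftrightarrow> D \<subseteq> X \<and> (\<forall>h\<in>X. \<forall>e>0. \<exists>d\<in>D. d \<in> X \<and> N (d - h) < e)"
    unfolding dense_subset_def norm_topology_def by blast
  show ?thesis
    unfolding * subset_iff by meson
qed

text \<open>Continuity at 0 gives a ball of radius r on which the values at w have modulus below 1.
  Rescaling h to norm r / 2 yields the constant 2 / r.\<close>

lemma evaluation_bounded: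
  assumes "continuous_map (norm_topology X N) euclidean (\<lambda>h. h w)"
  obtains K where "\<And>h. h \<in> X \<Longrightarrow> cmod (h w) \<le> K * N h"
proof -
  let ?U = "{h \<in> X. h w \<in> ball 0 1}"
  have "openin mtopology ?U"
    using openin_continuous_map_preimage[OF assms, of "ball 0 1"] by (simp add: norm_topology_def)
  moreover have "0 \<in> ?U"
    by (simp add: zero_mem)
  ultimately obtain r where r: "r > 0" "mball 0 r \<subseteq> ?U"
    by (auto simp: openin_mtopology)
  have "cmod (h w) \<le> 2 / r * N h" if h: "h \<in> X" for h
  proof (cases "N h = 0")
    case True
    then show ?thesis using h by (simp add: norm_eq_zero)
  next
    case False
    with norm_nonneg[OF h] have pos: "N h > 0" by simp
    let ?c = "of_real (r / (2 * N h)) :: complex"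
    have c: "cmod ?c = r / (2 * N h)"
      using pos r(1) by (simp only: norm_of_real) simp
    have "N (\<lambda>z. ?c * h z) < r"
      using pos r(1) by (simp only: norm_scale[OF h] c) simp
    then have "(\<lambda>z. ?c * h z) \<in> mball 0 r"
      using h zero_mem scale_mem[OF h] by (simp only: in_norm_ball diff_zero simp_thms)
    with r(2) have "cmod (?c * h w) < 1" by auto
    then have "r / (2 * N h) * cmod (h w) < 1"
      by (simp only: norm_mult c)
    then show ?thesis
      using pos r(1) by (simp add: field_simps)
  qed
  then show ?thesis by (rule that)
qed

end

text \<open>Steps decaying geometrically are summable, so completeness gives a limit. The last
  conclusion, on the total displacement, becomes the operator bound in
  \<open>closed_graph\<close>.\<close>

lemma (in banach_function_space) geometric_Cauchy_limit:
  assumes s: "\<And>n. s n \<in> X" and step: "\<And>n. N (s (Suc n) - s n) \<le> c * (1 / 2) ^ n"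
  obtains u where "u \<in> X" "(\<lambda>n. N (s n - u)) \<longlonglongrightarrow> 0" "N (s 0 - u) \<le> 2 * c"
proof -
  \<comment> \<open>The difference of powers is the exact partial geometric sum, which lets the
    induction on k close.\<close>
  have bound: "N (s (n + k) - s n) \<le> 2 * c * ((1 / 2) ^ n - (1 / 2) ^ (n + k))" for n k
  proof (induction k)
    case (Suc k)
    have "N (s (n + Suc k) - s n) \<le> N (s (Suc (n + k)) - s (n + k)) + N (s (n + k) - s n)"
      using norm_diff_triangle[of "s (Suc (n + k))" "s (n + k)" "s n"] s by simp
    also have "\<dots> \<le> c * (1 / 2) ^ (n + k) + 2 * c * ((1 / 2) ^ n - (1 / 2) ^ (n + k))"
      by (intro add_mono step Suc.IH)
    also have "\<dots> = 2 * c * ((1 / 2) ^ n - (1 / 2) ^ (n + Suc k))"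
      by (simp add: algebra_simps)
    finally show ?case .
  qed simp
  have "c \<ge> 0"
    using step[of 0] norm_nonneg[of "s 1 - s 0"] s by (simp add: diff_mem)
  have bound': "N (s m - s n) \<le> 2 * c * (1 / 2) ^ n" if "n \<le> m" for m n
  proof -
    have "2 * c * ((1 / 2) ^ n - (1 / 2) ^ m) \<le> 2 * c * (1 / 2) ^ n"
      using \<open>c \<ge> 0\<close> by (simp add: right_diff_distrib)
    with bound[of n "m - n"] that show ?thesis by simp
  qed
  have lim: "(\<lambda>n. 2 * c * (1 / 2) ^ n) \<longlonglongrightarrow> 0"
    by (intro tendsto_mult_right_zero LIMSEQ_power_zero) simp
  have "MCauchy s"
    unfolding MCauchy_def
  proof (intro conjI allI impI)
    fix e :: real assume "e > 0"
    with lim have "\<forall>\<^sub>F n in sequentially. 2 * c * (1 / 2) ^ n < e"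
      by (intro order_tendstoD) auto
    then obtain n0 where n0: "\<And>n. n \<ge> n0 \<Longrightarrow> 2 * c * (1 / 2) ^ n < e"
      by (auto simp: eventually_sequentially)
    have "N (s n - s m) < e" if "n \<ge> n0" "m \<ge> n0" for n m
      using bound'[of n m] bound'[of m n] n0[OF that(1)] n0[OF that(2)] norm_diff_commute[OF s s, of n m]
      by (cases "n \<le> m") auto
    then show "\<exists>n0. \<forall>n n'. n0 \<le> n \<longrightarrow> n0 \<le> n' \<longrightarrow> norm_dist X N (s n) (s n') < e"
      using s by (auto simp: norm_dist_def)
  qed (use s in auto)
  then obtain u where "limitin mtopology s u sequentially"
    using complete by (auto simp: mcomplete_def)
  then have u: "u \<in> X" "(\<lambda>n. N (s n - u)) \<longlonglongrightarrow> 0"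
    using s by (auto simp: limitin_metric_dist_null norm_dist_def)
  have "N (s 0 - u) - 2 * c \<le> N (s n - u)" for n
    using norm_diff_triangle[of "s 0" "s n" u] bound'[of 0 n] norm_diff_commute[of "s 0" "s n"] s u(1)
    by simp
  then have "N (s 0 - u) - 2 * c \<le> 0"
    using u(2) by (intro LIMSEQ_le_const[of "\<lambda>n. N (s n - u)"]) auto
  with u show ?thesis by (intro that) auto
qed

text \<open>
  By Baire, the elements \<open>h\<close> with \<open>M (T h) \<le> k\<close> are dense in some ball; approximating \<open>h\<close> by such
  elements, then the remainder, and so on, makes the images of the remainders converge.
\<close>

theorem closed_graph:
  assumes "banach_function_space X N" "banach_function_space Y M"
    and T: "\<And>h. h \<in> X \<Longrightarrow> T h \<in> Y"
      "\<And>h k. h \<in> X \<Longrightarrow> k \<in> X \<Longrightarrow> T (h + k) = T h + T k"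
      "\<And>c h. h \<in> X \<Longrightarrow> T (\<lambda>z. c * h z) = (\<lambda>z. c * T h z)"
    and closed: "\<And>h u. (\<And>n. h n \<in> X) \<Longrightarrow> u \<in> Y \<Longrightarrow> (\<lambda>n. N (h n)) \<longlonglongrightarrow> 0
        \<Longrightarrow> (\<lambda>n. M (T (h n) - u)) \<longlonglongrightarrow> 0 \<Longrightarrow> u = 0"
  obtains K where "\<And>h. h \<in> X \<Longrightarrow> M (T h) \<le> K * N h"
proof -
  interpret X: banach_function_space X N by fact
  interpret Y: banach_function_space Y M by fact
  have T_diff: "T (h - k) = T h - T k" if "h \<in> X" "k \<in> X" for h k
    using T(2)[of "h - k" k] that by (simp add: X.diff_mem eq_diff_eq)
  \<comment> \<open>These sublevel sets cover X, so by Baire the closure of one of them has interior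
    points.\<close>
  define V where "V k = {h \<in> X. M (T h) \<le> real k}" for k :: nat
  have "\<exists>k. X.mtopology interior_of (X.mtopology closure_of V k) \<noteq> {}"
  proof (rule ccontr)
    assume "\<nexists>k. X.mtopology interior_of (X.mtopology closure_of V k) \<noteq> {}"
    then have "X.mtopology interior_of \<Union>(range (\<lambda>k. X.mtopology closure_of V k)) = {}"
      using X.complete by (intro X.metric_Baire_category_alt) auto
    moreover have "\<Union>(range (\<lambda>k. X.mtopology closure_of V k)) = X"
    proof
      show "X \<subseteq> \<Union>(range (\<lambda>k. X.mtopology closure_of V k))"
      proof
        fix h assume h: "h \<in> X"
        obtain k where "M (T h) \<le> real k" using real_arch_simple by blast
        with h have "h \<in> V k" by (simp add: V_def)
        moreover have "V k \<subseteq> X" by (auto simp: V_def)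
        ultimately show "h \<in> \<Union>(range (\<lambda>k. X.mtopology closure_of V k))"
          using closure_of_subset[of "V k" X.mtopology] by auto
      qed
    qed (use closure_of_subset_topspace[of X.mtopology] in auto)
    ultimately show False
      using X.zero_mem interior_of_topspace[of X.mtopology] by auto
  qed
  then obtain k h0 r where r: "r > 0" "h0 \<in> X" "X.mball h0 r \<subseteq> X.mtopology closure_of V k"
    by (auto simp: X.metric_interior_of)
  have near_h0: "\<exists>v\<in>V k. N (v - (h0 + h)) < e" if "h \<in> X" "N h < r" "e > 0" for h e
  proof -
    have "h0 + h \<in> X.mball h0 r"
      using that r(2) by (simp add: X.in_norm_ball X.add_mem del: X.in_mball)
    with r(3) have "h0 + h \<in> X.mtopology closure_of V k" by blast
    with that(3) obtain v where "v \<in> V k" "v \<in> X.mball (h0 + h) e"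
      unfolding X.metric_closure_of by blast
    then show ?thesis
      unfolding X.in_norm_ball by blast
  qed
  have near: "\<exists>v\<in>X. M (T v) \<le> real k \<and> N (h - v) < e" if h: "h \<in> X" "N h < r" "e > 0" for h e
  proof -
    obtain v where v: "v \<in> V k" "N (v - (h0 + h)) < e"
      using near_h0[OF h] by blast
    obtain w where w: "w \<in> V k" "N (w - (h0 + - h)) < e"
      using near_h0[of "- h" e] h by (auto simp: X.uminus_mem X.norm_uminus)
    have vw: "v \<in> X" "w \<in> X" "M (T v) \<le> real k" "M (T w) \<le> real k"
      using v w by (auto simp: V_def)
    \<comment> \<open>With v near h0 + h and w near h0 - h, half the difference is near h. This
      moves the ball from h0 to the origin while keeping the bound k.\<close>
    define u where "u = (\<lambda>z. (1 / 2) * (v - w) z)"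
    define a where "a = v - (h0 + h)"
    define b where "b = w - (h0 + - h)"
    have mem: "a \<in> X" "b \<in> X" "v - w \<in> X"
      unfolding a_def b_def by (intro X.diff_mem X.add_mem X.uminus_mem vw h r(2))+
    then have u: "u \<in> X"
      unfolding u_def by (intro X.scale_mem)
    have "M (T u) = cmod (1 / 2) * M (T (v - w))"
      unfolding u_def using mem by (simp only: T(3) Y.norm_scale T(1))
    also have "M (T (v - w)) \<le> M (T v) + M (T w)"
      unfolding T_diff[OF vw(1,2)] by (intro Y.norm_triangle_diff T(1) vw)
    finally have "M (T u) \<le> real k" using vw by simp
    moreover have "u - h = (\<lambda>z. (1 / 2) * (a - b) z)"
      by (simp add: fun_eq_iff u_def a_def b_def field_simps)
    then have "N (u - h) = cmod (1 / 2) * N (a - b)"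
      using mem by (simp only: X.norm_scale X.diff_mem)
    then have "N (h - u) < e"
      using X.norm_triangle_diff[OF mem(1,2)] v(2) w(2)
      unfolding X.norm_diff_commute[OF h(1) u] a_def b_def by simp
    ultimately show ?thesis
      using u by blast
  qed
  define K where "K = 2 * real k / r"
  have approx: "\<exists>v\<in>X. M (T v) \<le> K * t \<and> N (h - v) < e"
    if h: "h \<in> X" "N h \<le> t" and "t > 0" "e > 0" for h t e
  proof -
    \<comment> \<open>The scalar c brings h into the ball of radius r, and its inverse d carries the
      approximant back; d multiplies the bound k by 2 t / r, whence K.\<close>
    obtain c d :: complex where c: "cmod c = r / (2 * t)" "cmod d = 2 * t / r" "d * c = 1"
      using r(1) \<open>t > 0\<close>
      by (intro that[of "of_real (r / (2 * t))" "of_real (2 * t / r)"])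
         (simp_all only: norm_of_real flip: of_real_mult, simp_all)
    have "r / (2 * t) * N h \<le> r / (2 * t) * t"
      using h r(1) \<open>t > 0\<close> by (intro mult_left_mono) auto
    also have "\<dots> < r" using r(1) \<open>t > 0\<close> by simp
    finally have "N (\<lambda>z. c * h z) < r"
      by (simp only: X.norm_scale[OF h(1)] c)
    then obtain v where v: "v \<in> X" "M (T v) \<le> real k" "N ((\<lambda>z. c * h z) - v) < e * r / (2 * t)"
      using near[OF X.scale_mem[OF h(1), of c], of "e * r / (2 * t)"] r(1) \<open>t > 0\<close> \<open>e > 0\<close>
      by auto
    have "M (T (\<lambda>z. d * v z)) = 2 * t / r * M (T v)"
      using v by (simp only: T(3) Y.norm_scale T(1) c)
    also have "\<dots> \<le> 2 * t / r * real k"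
      using v r(1) \<open>t > 0\<close> by (intro mult_left_mono) auto
    finally have 1: "M (T (\<lambda>z. d * v z)) \<le> K * t" by (simp add: K_def mult_ac)
    have "h z - d * v z = d * (c * h z - v z)" for z
      by (simp only: right_diff_distrib mult.assoc[symmetric] c(3) mult_1)
    then have "h - (\<lambda>z. d * v z) = (\<lambda>z. d * ((\<lambda>z. c * h z) - v) z)"
      by (simp add: fun_eq_iff)
    then have "N (h - (\<lambda>z. d * v z)) = 2 * t / r * N ((\<lambda>z. c * h z) - v)"
      using v X.scale_mem[OF h(1)] by (simp only: X.norm_scale X.diff_mem c)
    also have "\<dots> < 2 * t / r * (e * r / (2 * t))"
      using v r(1) \<open>t > 0\<close> by (intro mult_strict_left_mono) auto
    finally have "N (h - (\<lambda>z. d * v z)) < e"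
      using r(1) \<open>t > 0\<close> by simp
    with 1 show ?thesis
      using X.scale_mem[OF v(1)] by blast
  qed
  have "M (T h) \<le> 2 * K * N h" if h: "h \<in> X" for h
  proof (cases "N h = 0")
    case True
    then have "h = 0" using h X.norm_eq_zero by simp
    then have "T h = 0" using T_diff[of 0 0] X.zero_mem by simp
    then show ?thesis using True by simp
  next
    case False
    define t where "t = N h"
    have "t > 0" using False X.norm_nonneg[OF h] by (simp add: t_def)
    define F where "F g n = (SOME v. v \<in> X \<and> M (T v) \<le> K * (t * (1 / 2) ^ n)
      \<and> N (g - v) < t * (1 / 2) ^ Suc n)" for g n
    have F: "F g n \<in> X" "M (T (F g n)) \<le> K * (t * (1 / 2) ^ n)" "N (g - F g n) < t * (1 / 2) ^ Suc n"
      if g: "g \<in> X" "N g \<le> t * (1 / 2) ^ n" for g n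
    proof -
      have "\<exists>v. v \<in> X \<and> M (T v) \<le> K * (t * (1 / 2) ^ n) \<and> N (g - v) < t * (1 / 2) ^ Suc n"
        using approx[OF g, of "t * (1 / 2) ^ Suc n"] \<open>t > 0\<close> by auto
      from someI_ex[OF this] show "F g n \<in> X" "M (T (F g n)) \<le> K * (t * (1 / 2) ^ n)"
        "N (g - F g n) < t * (1 / 2) ^ Suc n"
        unfolding F_def by blast+
    qed
    \<comment> \<open>The remainders of successive approximation, halved in norm bound at each
      stage.\<close>
    define \<rho> where "\<rho> = rec_nat h (\<lambda>n g. g - F g n)"
    have \<rho>_Suc: "\<rho> (Suc n) = \<rho> n - F (\<rho> n) n" for n by (simp add: \<rho>_def)
    have \<rho>: "\<rho> n \<in> X \<and> N (\<rho> n) \<le> t * (1 / 2) ^ n" for n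
    proof (induction n)
      case (Suc n)
      then show ?case
        unfolding \<rho>_Suc using F(1,3)[of "\<rho> n" n] X.diff_mem less_imp_le by blast
    qed (use h in \<open>simp add: \<rho>_def t_def\<close>)
    have "M (T (\<rho> (Suc n)) - T (\<rho> n)) \<le> K * t * (1 / 2) ^ n" for n
    proof -
      have F': "F (\<rho> n) n \<in> X" "M (T (F (\<rho> n) n)) \<le> K * (t * (1 / 2) ^ n)"
        using \<rho>[of n] F(1,2)[of "\<rho> n" n] by blast+
      have "T (\<rho> (Suc n)) - T (\<rho> n) = - T (F (\<rho> n) n)"
        unfolding \<rho>_Suc using \<rho>[of n] F'(1) by (subst T_diff) simp_all
      then have "M (T (\<rho> (Suc n)) - T (\<rho> n)) = M (T (F (\<rho> n) n))"
        using Y.norm_uminus[OF T(1)[OF F'(1)]] by (simp only:)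
      then show ?thesis
        using F'(2) by (simp only: mult.assoc)
    qed
    moreover have "T (\<rho> n) \<in> Y" for n
      using \<rho> T(1) by blast
    ultimately obtain u where u: "u \<in> Y" "(\<lambda>n. M (T (\<rho> n) - u)) \<longlonglongrightarrow> 0" "M (T (\<rho> 0) - u) \<le> 2 * (K * t)"
      using Y.geometric_Cauchy_limit[of "\<lambda>n. T (\<rho> n)" "K * t"] by blast
    have geo: "(\<lambda>n. t * (1 / 2) ^ n) \<longlonglongrightarrow> 0"
      by (intro tendsto_mult_right_zero LIMSEQ_power_zero) simp
    have "(\<lambda>n. N (\<rho> n)) \<longlonglongrightarrow> 0"
    proof (rule tendsto_sandwich[OF _ _ tendsto_const geo])
      show "\<forall>\<^sub>F n in sequentially. 0 \<le> N (\<rho> n)"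
        using \<rho> X.norm_nonneg by (intro always_eventually) blast
      show "\<forall>\<^sub>F n in sequentially. N (\<rho> n) \<le> t * (1 / 2) ^ n"
        using \<rho> by (intro always_eventually) blast
    qed
    \<comment> \<open>The remainders tend to 0 while their images tend to u, so closedness applies.
      Then \<open>u(3)\<close> bounds the image of the initial remainder h.\<close>
    then have "u = 0"
      using \<rho> by (intro closed[OF _ u(1) _ u(2)]) blast+
    moreover have "\<rho> 0 = h" by (simp add: \<rho>_def)
    ultimately show ?thesis
      using u(3) by (simp add: t_def)
  qed
  then show ?thesis by (rule that)
qed

text \<open>Convergence in either norm implies pointwise convergence on the disc, so multiplication
  has closed graph. Two spaces are allowed, to cover both multiplication by f on X and
  multiplication by a polynomial from A to X.\<close>

lemma multiplication_bounded:
  assumes X: "banach_function_space X N" and Y: "banach_function_space Y M"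
    and ev_X: "\<And>w. w \<in> \<D> \<Longrightarrow> continuous_map (norm_topology X N) euclidean (\<lambda>h. h w)"
    and ev_Y: "\<And>w. w \<in> \<D> \<Longrightarrow> continuous_map (norm_topology Y M) euclidean (\<lambda>h. h w)"
    and mult: "\<And>h. h \<in> X \<Longrightarrow> \<phi> * h \<in> Y"
  obtains K where "\<And>h. h \<in> X \<Longrightarrow> M (\<phi> * h) \<le> K * N h" "K > 0"
proof -
  interpret X: banach_function_space X N by fact
  interpret Y: banach_function_space Y M by fact
  have *: "u = 0"
    if h: "\<And>n. h n \<in> X" and u: "u \<in> Y"
      and lim: "(\<lambda>n. N (h n)) \<longlonglongrightarrow> 0" "(\<lambda>n. M (\<phi> * h n - u)) \<longlonglongrightarrow> 0" for h u
  proof -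
    have "u w = 0" if w: "w \<in> \<D>" for w
    proof -
      obtain a where a: "\<And>h. h \<in> X \<Longrightarrow> cmod (h w) \<le> a * N h"
        using X.evaluation_bounded[OF ev_X[OF w]] by blast
      obtain b where b: "\<And>h. h \<in> Y \<Longrightarrow> cmod (h w) \<le> b * M h"
        using Y.evaluation_bounded[OF ev_Y[OF w]] by blast
      have "(\<lambda>n. a * N (h n)) \<longlonglongrightarrow> 0" "(\<lambda>n. b * M (\<phi> * h n - u)) \<longlonglongrightarrow> 0"
        by (intro tendsto_mult_right_zero lim)+
      moreover have "cmod (h n w) \<le> a * N (h n)" "cmod ((\<phi> * h n - u) w) \<le> b * M (\<phi> * h n - u)" for n
        using a[OF h] b[OF Y.diff_mem[OF mult[OF h] u]] .
      ultimately have "(\<lambda>n. h n w) \<longlonglongrightarrow> 0" "(\<lambda>n. (\<phi> * h n - u) w) \<longlonglongrightarrow> 0"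
        by - (rule Lim_null_comparison[OF always_eventually], rule allI, assumption+)+
      then have "(\<lambda>n. \<phi> w * h n w - (\<phi> * h n - u) w) \<longlonglongrightarrow> \<phi> w * 0 - 0"
        by (intro tendsto_intros)
      then show ?thesis by (simp add: LIMSEQ_const_iff)
    qed
    then show "u = 0"
      using Y.zero_outside[OF u] by (auto simp: fun_eq_iff)
  qed
  have scale: "\<phi> * (\<lambda>z. c * h z) = (\<lambda>z. c * (\<phi> * h) z)" for c h
    by (simp add: fun_eq_iff)
  obtain K where K: "\<And>h. h \<in> X \<Longrightarrow> M (\<phi> * h) \<le> K * N h"
  proof (rule closed_graph[OF X Y mult distrib_left scale])
    fix h u
    assume "\<And>n. h n \<in> X" "u \<in> Y" "(\<lambda>n. N (h n)) \<longlonglongrightarrow> 0" "(\<lambda>n. M (\<phi> * h n - u)) \<longlonglongrightarrow> 0"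
    then show "u = 0" by (rule *)
  qed (blast intro: that)+
  show ?thesis
  proof (rule that)
    show "M (\<phi> * h) \<le> (\<bar>K\<bar> + 1) * N h" if "h \<in> X" for h
    proof (rule order_trans[OF K[OF that]])
      show "K * N h \<le> (\<bar>K\<bar> + 1) * N h"
        using X.norm_nonneg[OF that] by (intro mult_right_mono) auto
    qed
  qed simp
qed

subsection \<open>Corona solutions as resolvents\<close>

lemma on_disc_eq: "(\<And>z. z \<notin> \<D> \<Longrightarrow> h z = 0) \<Longrightarrow> on_disc h = h"
  by (auto simp: on_disc_def fun_eq_iff)

context banach_function_algebra
begin

lemma on_disc_mem: "h \<in> A \<Longrightarrow> on_disc h = h"
  using zero_outside by (intro on_disc_eq) blast

text \<open>Evaluation is multiplicative: its bound K applied to the powers of h would fail for a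
  large exponent if the value exceeded the norm.\<close>

lemma evaluation_le_norm:
  assumes ev: "continuous_map (norm_topology A N) euclidean (\<lambda>h. h w)" and h: "h \<in> A"
  shows "cmod (h w) \<le> N h"
proof (rule ccontr)
  assume less: "\<not> cmod (h w) \<le> N h"
  then have "h \<noteq> 0" by auto
  with h have pos: "N h > 0"
    using norm_nonneg[OF h] norm_eq_zero[OF h] by simp
  obtain K where K: "\<And>h. h \<in> A \<Longrightarrow> cmod (h w) \<le> K * N h"
    using evaluation_bounded[OF ev] by blast
  \<comment> \<open>Exponents start at 1: \<open>h ^ 0\<close> is the constant 1 on the whole plane,
    which is not in A.\<close>
  have power: "h ^ Suc n \<in> A \<and> N (h ^ Suc n) \<le> N h ^ Suc n \<and> (h ^ Suc n) w = h w ^ Suc n" for n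
  proof (induction n)
    case (Suc n)
    have "N (h * h ^ Suc n) \<le> N h * N (h ^ Suc n)"
      by (intro norm_mult h Suc.IH[THEN conjunct1])
    also have "\<dots> \<le> N h * N h ^ Suc n"
      by (intro mult_left_mono norm_nonneg h Suc.IH[THEN conjunct2, THEN conjunct1])
    finally have "N (h ^ Suc (Suc n)) \<le> N h ^ Suc (Suc n)"
      by (simp only: power_Suc)
    moreover have "h ^ Suc (Suc n) \<in> A"
      unfolding power_Suc[of h "Suc n"] by (intro mult_mem h Suc.IH[THEN conjunct1])
    moreover have "(h ^ Suc (Suc n)) w = h w * h w ^ Suc n"
      unfolding power_Suc[of h "Suc n"] times_fun_apply
      by (simp only: Suc.IH[THEN conjunct2, THEN conjunct2])
    ultimately show ?case
      by (simp only: power_Suc simp_thms)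
  qed (use h in simp)
  have "1 < cmod (h w) / N h" using less pos by simp
  then obtain n where n: "\<bar>K\<bar> < (cmod (h w) / N h) ^ n"
    using real_arch_pow by blast
  also have "\<dots> \<le> (cmod (h w) / N h) ^ Suc n"
    using \<open>1 < cmod (h w) / N h\<close> by (intro power_increasing) auto
  finally have "\<bar>K\<bar> * N h ^ Suc n < cmod (h w) ^ Suc n"
    using pos by (simp add: power_divide less_divide_eq)
  also have "\<dots> = cmod ((h ^ Suc n) w)"
    using power by (simp only: norm_power)
  also have "\<dots> \<le> K * N (h ^ Suc n)"
    using power by (intro K) blast
  also have "\<dots> \<le> \<bar>K\<bar> * N (h ^ Suc n)"
    using power norm_nonneg by (intro mult_right_mono) auto
  also have "\<dots> \<le> \<bar>K\<bar> * N h ^ Suc n"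
    using power by (intro mult_left_mono) auto
  finally show False by simp
qed

section \<open>The distance to a principal ideal as a seminorm\<close>

definition ideal_dist :: "(complex \<Rightarrow> complex) \<Rightarrow> (complex \<Rightarrow> complex) \<Rightarrow> real" where
  "ideal_dist f u = (INF k\<in>A. N (on_disc u - f * k))"

lemma ideal_dist_le:
  assumes "f \<in> A" "on_disc u \<in> A" "k \<in> A"
  shows "ideal_dist f u \<le> N (on_disc u - f * k)"
  unfolding ideal_dist_def
proof (rule cINF_lower)
  show "bdd_below ((\<lambda>k. N (on_disc u - f * k)) ` A)"
    using assms by (intro bdd_belowI2[of _ 0] norm_nonneg diff_mem mult_mem)
qed fact

lemma ideal_dist_approx:
  assumes "ideal_dist f u < r"
  obtains k where "k \<in> A" "N (on_disc u - f * k) < r"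
proof -
  have "(\<lambda>k. N (on_disc u - f * k)) ` A \<noteq> {}"
    using zero_mem by auto
  from cInf_lessD[OF this, of r] assms show ?thesis
    using that unfolding ideal_dist_def by blast
qed

lemma ideal_dist_greatest:
  assumes "\<And>k. k \<in> A \<Longrightarrow> r \<le> N (on_disc u - f * k)"
  shows "r \<le> ideal_dist f u"
  unfolding ideal_dist_def using zero_mem assms by (intro cINF_greatest) auto

lemma on_disc_ring:
  "on_disc (u + v) = on_disc u + on_disc v"
  "on_disc (u * v) = on_disc u * on_disc v"
  "on_disc ((\<lambda>z. c) * u) = (\<lambda>z. c * on_disc u z)"
  by (auto simp: on_disc_def fun_eq_iff)

text \<open>The carrier consists of functions whose restriction to the disc is in A, so it contains
  the unit 1 of the function ring, which does not vanish outside the disc.\<close>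

lemma complex_algebra_seminorm_ideal_dist:
  assumes f: "f \<in> A"
  shows "complex_algebra_seminorm {u. on_disc u \<in> A} (\<lambda>c z. c) (ideal_dist f)"
proof
  show "(\<lambda>z. c) \<in> {u. on_disc u \<in> A}" for c
    using scale_mem[OF unit_mem, of c] by (simp add: on_disc_def if_distrib cong: if_cong)
  show "u + v \<in> {u. on_disc u \<in> A}" "u * v \<in> {u. on_disc u \<in> A}"
    if "u \<in> {u. on_disc u \<in> A}" "v \<in> {u. on_disc u \<in> A}" for u v
    using that by (simp_all add: on_disc_ring add_mem mult_mem)
  show "ideal_dist f (u + v) \<le> ideal_dist f u + ideal_dist f v"
    if "u \<in> {u. on_disc u \<in> A}" "v \<in> {u. on_disc u \<in> A}" for u v
  proof (rule field_le_epsilon)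
    fix e :: real assume "e > 0"
    have uv: "on_disc u \<in> A" "on_disc v \<in> A" using that by auto
    obtain k where k: "k \<in> A" "N (on_disc u - f * k) < ideal_dist f u + e / 2"
      using ideal_dist_approx[of f u "ideal_dist f u + e / 2"] \<open>e > 0\<close> by auto
    obtain l where l: "l \<in> A" "N (on_disc v - f * l) < ideal_dist f v + e / 2"
      using ideal_dist_approx[of f v "ideal_dist f v + e / 2"] \<open>e > 0\<close> by auto
    have "ideal_dist f (u + v) \<le> N (on_disc (u + v) - f * (k + l))"
      using uv k l f by (intro ideal_dist_le add_mem) (simp_all add: on_disc_ring add_mem)
    also have "on_disc (u + v) - f * (k + l) = (on_disc u - f * k) + (on_disc v - f * l)"
      by (simp add: on_disc_ring algebra_simps)
    also have "N \<dots> \<le> N (on_disc u - f * k) + N (on_disc v - f * l)"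
      using uv k l f by (intro norm_triangle diff_mem mult_mem)
    finally show "ideal_dist f (u + v) \<le> ideal_dist f u + ideal_dist f v + e"
      using k(2) l(2) by linarith
  qed
  show "ideal_dist f (u * v) \<le> ideal_dist f u * ideal_dist f v"
    if "u \<in> {u. on_disc u \<in> A}" "v \<in> {u. on_disc u \<in> A}" for u v
  proof -
    have uv: "on_disc u \<in> A" "on_disc v \<in> A" using that by auto
    \<comment> \<open>The infima need not be attained, hence the slack e, removed by a one-sided
      limit.\<close>
    have le: "ideal_dist f (u * v) \<le> (ideal_dist f u + e) * (ideal_dist f v + e)" if "e > 0" for e
    proof -
      obtain k where k: "k \<in> A" "N (on_disc u - f * k) < ideal_dist f u + e"
        using ideal_dist_approx[of f u "ideal_dist f u + e"] \<open>e > 0\<close> by auto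
      obtain l where l: "l \<in> A" "N (on_disc v - f * l) < ideal_dist f v + e"
        using ideal_dist_approx[of f v "ideal_dist f v + e"] \<open>e > 0\<close> by auto
      have mem: "on_disc u - f * k \<in> A" "on_disc v - f * l \<in> A"
        by (intro diff_mem mult_mem uv k l f)+
      \<comment> \<open>The element subtracted comes from expanding (u - f k) (v - f l) and
        collecting the multiples of f.\<close>
      have "ideal_dist f (u * v) \<le> N (on_disc (u * v) - f * (k * on_disc v + l * on_disc u - f * k * l))"
        using uv k l f
        by (intro ideal_dist_le add_mem diff_mem mult_mem) (simp_all add: on_disc_ring mult_mem)
      also have "on_disc (u * v) - f * (k * on_disc v + l * on_disc u - f * k * l)
          = (on_disc u - f * k) * (on_disc v - f * l)"
        by (simp add: on_disc_ring algebra_simps)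
      also have "N \<dots> \<le> N (on_disc u - f * k) * N (on_disc v - f * l)"
        by (intro norm_mult mem)
      also have "\<dots> \<le> (ideal_dist f u + e) * (ideal_dist f v + e)"
        using k l norm_nonneg[OF mem(1)] norm_nonneg[OF mem(2)] by (intro mult_mono) auto
      finally show ?thesis .
    qed
    have "((\<lambda>e. (ideal_dist f u + e) * (ideal_dist f v + e)) \<longlongrightarrow>
        (ideal_dist f u + 0) * (ideal_dist f v + 0)) (at_right 0)"
      by (intro tendsto_intros)
    moreover have "\<forall>\<^sub>F e in at_right 0. ideal_dist f (u * v) \<le> (ideal_dist f u + e) * (ideal_dist f v + e)"
      using le by (auto simp: eventually_at_right_field intro!: exI[of _ 1])
    ultimately show ?thesis
      using tendsto_lowerbound[of _ "(ideal_dist f u + 0) * (ideal_dist f v + 0)" "at_right (0::real)"]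
      by simp
  qed
  have div_iff: "x / cmod c \<le> y \<longleftrightarrow> x \<le> cmod c * y" "x \<le> cmod (inverse c) * y \<longleftrightarrow> cmod c * x \<le> y"
    if "c \<noteq> 0" for c x y
    using that by (simp_all only: norm_inverse) (simp_all add: field_simps)
  \<comment> \<open>For nonzero c one inequality suffices: applied to the inverse of c, it gives the
    other.\<close>
  have scale_le: "ideal_dist f ((\<lambda>z. c) * u) \<le> cmod c * ideal_dist f u"
    if u: "on_disc u \<in> A" and c: "c \<noteq> 0" for c u
  proof -
    have "ideal_dist f ((\<lambda>z. c) * u) / cmod c \<le> N (on_disc u - f * k)" if k: "k \<in> A" for k
    proof -
      have "ideal_dist f ((\<lambda>z. c) * u) \<le> N (on_disc ((\<lambda>z. c) * u) - f * (\<lambda>z. c * k z))"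
        using u k f by (intro ideal_dist_le scale_mem) (simp_all only: on_disc_ring(3) scale_mem)
      also have "on_disc ((\<lambda>z. c) * u) - f * (\<lambda>z. c * k z) = (\<lambda>z. c * (on_disc u - f * k) z)"
        by (simp only: on_disc_ring(3)) (simp add: fun_eq_iff algebra_simps)
      also have "N \<dots> = cmod c * N (on_disc u - f * k)"
        using u k f by (intro norm_scale diff_mem mult_mem)
      finally show ?thesis using div_iff(1)[OF c] by blast
    qed
    then have "ideal_dist f ((\<lambda>z. c) * u) / cmod c \<le> ideal_dist f u"
      by (rule ideal_dist_greatest)
    then show ?thesis using div_iff(1)[OF c] by blast
  qed
  show "ideal_dist f ((\<lambda>z. c) * u) = cmod c * ideal_dist f u" if "u \<in> {u. on_disc u \<in> A}" for c u
  proof (cases "c = 0")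
    case True
    have "on_disc 0 = 0"
      by (simp add: on_disc_def fun_eq_iff)
    then have "ideal_dist f 0 \<le> 0"
      using ideal_dist_le[OF f, of 0 0] zero_mem by simp
    moreover have "0 \<le> ideal_dist f 0"
      using f zero_mem \<open>on_disc 0 = 0\<close>
      by (intro ideal_dist_greatest norm_nonneg diff_mem mult_mem) auto
    moreover have "(\<lambda>z. c) * u = 0"
      using True by (simp add: fun_eq_iff)
    ultimately show ?thesis
      using True by simp
  next
    case False
    have u: "on_disc u \<in> A" using that by simp
    then have "on_disc ((\<lambda>z. c) * u) \<in> A"
      unfolding on_disc_ring(3) by (rule scale_mem)
    then have "ideal_dist f ((\<lambda>z. inverse c) * ((\<lambda>z. c) * u))
        \<le> cmod (inverse c) * ideal_dist f ((\<lambda>z. c) * u)"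
      using False by (intro scale_le) auto
    also have "(\<lambda>z. inverse c) * ((\<lambda>z. c) * u) = u"
      using False by (simp add: fun_eq_iff)
    finally have "cmod c * ideal_dist f u \<le> ideal_dist f ((\<lambda>z. c) * u)"
      using div_iff(2)[OF False] by blast
    with scale_le[OF u False] show ?thesis by (rule antisym)
  qed
qed (auto simp: fun_eq_iff)

text \<open>A Bezout identity for multiples of f and z - g makes one corona solution, rescaled, an
  inverse of z - g modulo multiples of f. Its polynomial bound is the hypothesis of
  \<open>power_null_of_resolvent_growth\<close>.\<close>

lemma power_in_closure_ideal:
  fixes C a :: real
  assumes ev: "\<And>w. w \<in> \<D> \<Longrightarrow> continuous_map (norm_topology A N) euclidean (\<lambda>h. h w)"
    and "C > 0"
    and corona: "\<forall>\<delta>>0. \<forall>f1\<in>A. \<forall>f2\<in>A.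
      (\<forall>z\<in>\<D>. \<delta> \<le> cmod (f1 z) + cmod (f2 z) \<and> cmod (f1 z) + cmod (f2 z) \<le> 1) \<longrightarrow>
      (\<exists>g1\<in>A. \<exists>g2\<in>A. (\<forall>z\<in>\<D>. f1 z * g1 z + f2 z * g2 z = 1) \<and>
         N g1 \<le> C / \<delta> powr a \<and> N g2 \<le> C / \<delta> powr a)"
    and f: "f \<in> A" and g: "g \<in> A" and le: "\<And>z. z \<in> \<D> \<Longrightarrow> cmod (g z) \<le> cmod (f z)"
  obtains m where "\<And>e. e > 0 \<Longrightarrow> \<exists>k\<in>A. N (on_disc (g ^ m) - f * k) < e"
proof -
  interpret Q: complex_algebra_seminorm "{u. on_disc u \<in> A}" "\<lambda>c z. c" "ideal_dist f"
    using f by (rule complex_algebra_seminorm_ideal_dist)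
  have g_mem: "g \<in> {u. on_disc u \<in> A}"
    using g by (simp add: on_disc_mem)
  \<comment> \<open>L exceeds the seminorm of g, c dominates |f| + |z - g| on the disc whenever |z|
    is at most L, and m rounds the exponent a up to a natural number.\<close>
  define L where "L = ideal_dist f g + 1"
  define c where "c = N f + N g + L"
  define m where "m = nat \<lceil>a\<rceil>"
  have L: "L \<ge> 1"
    using Q.q_nonneg[OF g_mem] by (simp add: L_def)
  then have c: "c \<ge> L" "c > 0"
    using norm_nonneg[OF f] norm_nonneg[OF g] by (auto simp: c_def)
  have res: "\<exists>b\<in>{u. on_disc u \<in> A}. ((\<lambda>w. z) - g) * b - 1 \<in> Q.null
      \<and> ideal_dist f b \<le> (C * c ^ m / c) / cmod z ^ m"
    if z: "0 < cmod z" "cmod z \<le> L" for z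
  proof -
    let ?s = "of_real (1 / c) :: complex"
    have s: "cmod ?s = 1 / c"
      using c by (simp only: norm_of_real) simp
    \<comment> \<open>Division by c meets the upper bound 1 of the corona hypothesis. The lower
      bound |z| / c comes from |z| being at most |g| + |z - g|, hence at most |f| + |z - g|.\<close>
    define f1 where "f1 = (\<lambda>w. ?s * f w)"
    define f2 where "f2 = (\<lambda>w. ?s * ((\<lambda>w. z * on_disc (\<lambda>w. 1) w) - g) w)"
    define \<delta> where "\<delta> = cmod z / c"
    have \<delta>: "\<delta> > 0" "\<delta> \<le> 1"
      using z c by (auto simp: \<delta>_def divide_le_eq)
    have f12: "f1 \<in> A" "f2 \<in> A"
      unfolding f1_def f2_def by (intro scale_mem diff_mem unit_mem f g)+
    have "\<forall>w\<in>\<D>. \<delta> \<le> cmod (f1 w) + cmod (f2 w) \<and> cmod (f1 w) + cmod (f2 w) \<le> 1"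
    proof
      fix w assume w: "w \<in> \<D>"
      have eq: "cmod (f1 w) + cmod (f2 w) = (cmod (f w) + cmod (z - g w)) / c"
        using w c by (simp add: f1_def f2_def on_disc_def norm_mult norm_divide add_divide_distrib)
      have "cmod z \<le> cmod (g w) + cmod (z - g w)"
        using norm_triangle_ineq[of "g w" "z - g w"] by simp
      moreover have "cmod (z - g w) \<le> cmod z + cmod (g w)"
        by (rule norm_triangle_ineq4)
      ultimately have "cmod z \<le> cmod (f w) + cmod (z - g w)" "cmod (f w) + cmod (z - g w) \<le> c"
        using le[OF w] z evaluation_le_norm[OF ev[OF w] f] evaluation_le_norm[OF ev[OF w] g]
        by (auto simp: c_def)
      then show "\<delta> \<le> cmod (f1 w) + cmod (f2 w) \<and> cmod (f1 w) + cmod (f2 w) \<le> 1"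
        unfolding eq \<delta>_def using c by (auto simp: divide_right_mono)
    qed
    with corona \<delta>(1) f12 have "\<exists>g1\<in>A. \<exists>g2\<in>A. (\<forall>w\<in>\<D>. f1 w * g1 w + f2 w * g2 w = 1) \<and>
         N g1 \<le> C / \<delta> powr a \<and> N g2 \<le> C / \<delta> powr a"
      by simp
    then obtain g1 g2 where
      g12: "g1 \<in> A" "g2 \<in> A" "\<And>w. w \<in> \<D> \<Longrightarrow> f1 w * g1 w + f2 w * g2 w = 1" "N g2 \<le> C / \<delta> powr a"
      by blast
    \<comment> \<open>The corona identity now reads (z - g) b - 1 = f k on the disc; the sign in k
      comes from moving the f1 term to the other side.\<close>
    define b where "b = (\<lambda>w. ?s * g2 w)"
    define k where "k = (\<lambda>w. - ?s * g1 w)"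
    have bk: "b \<in> A" "k \<in> A"
      unfolding b_def k_def by (intro scale_mem g12)+
    have b_mem: "b \<in> {u. on_disc u \<in> A}"
      using bk by (simp add: on_disc_mem)
    have mem: "((\<lambda>w. z) - g) * b - 1 \<in> {u. on_disc u \<in> A}"
      by (intro Q.mem g_mem b_mem)
    have "on_disc (((\<lambda>w. z) - g) * b - 1) - f * k = 0"
    proof
      fix w
      show "(on_disc (((\<lambda>w. z) - g) * b - 1) - f * k) w = 0 w"
      proof (cases "w \<in> \<D>")
        case True
        have "f1 w * g1 w + f2 w * g2 w = ?s * f w * g1 w + ?s * (z - g w) * g2 w"
          using True by (simp add: f1_def f2_def on_disc_def)
        with g12(3)[OF True] have "?s * f w * g1 w + ?s * (z - g w) * g2 w = 1"
          by simp
        moreover have "(on_disc (((\<lambda>w. z) - g) * b - 1) - f * k) w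
            = (?s * f w * g1 w + ?s * (z - g w) * g2 w) - 1"
          using True by (simp add: on_disc_def b_def k_def)
        ultimately show ?thesis by simp
      next
        case False
        then show ?thesis using zero_outside[OF f] by (simp add: on_disc_def)
      qed
    qed
    then have "ideal_dist f (((\<lambda>w. z) - g) * b - 1) \<le> 0"
      using ideal_dist_le[OF f _ bk(2), of "((\<lambda>w. z) - g) * b - 1"] mem by simp
    then have null: "((\<lambda>w. z) - g) * b - 1 \<in> Q.null"
      using mem Q.q_nonneg[OF mem] by (simp add: Q.null_def)
    have "ideal_dist f b \<le> N b"
      using ideal_dist_le[OF f _ zero_mem, of b] bk by (simp add: on_disc_mem)
    also have "\<dots> = N g2 / c"
      unfolding b_def norm_scale[OF g12(2)] s by simp
    also have "\<dots> \<le> (C / \<delta> ^ m) / c"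
    proof (intro divide_right_mono)
      \<comment> \<open>As \<delta> is at most 1, raising the exponent from a to m only weakens the
        bound.\<close>
      have "a \<le> real m" by (simp add: m_def real_nat_ceiling_ge)
      then have "\<delta> powr m \<le> \<delta> powr a"
        using \<delta> by (intro powr_mono') auto
      then have "C / \<delta> powr a \<le> C / \<delta> ^ m"
        using \<delta> \<open>C > 0\<close> by (intro divide_left_mono) (auto simp: powr_realpow)
      with g12(4) show "N g2 \<le> C / \<delta> ^ m" by simp
    qed (use c in simp)
    also have "\<dots> = (C * c ^ m / c) / cmod z ^ m"
      by (simp add: \<delta>_def power_divide)
    finally show ?thesis
      using null b_mem by blast
  qed
  have "g ^ m \<in> Q.null"
    by (rule Q.power_null_of_resolvent_growth[OF g_mem _ res]) (auto simp: L_def)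
  then have "ideal_dist f (g ^ m) = 0"
    by (simp add: Q.null_def)
  show ?thesis
  proof (rule that)
    show "\<exists>k\<in>A. N (on_disc (g ^ m) - f * k) < e" if "e > 0" for e
      using ideal_dist_approx[of f "g ^ m" e] \<open>ideal_dist f (g ^ m) = 0\<close> that by metis
  qed
qed

end

text \<open>Approximate h by p \<psi>, then p by r \<phi>; boundedness of multiplication by \<psi>
  carries the second approximation over to p \<psi>.\<close>

lemma shift_cyclic_mult:
  assumes X: "banach_function_space X N"
    and ev: "\<And>w. w \<in> \<D> \<Longrightarrow> continuous_map (norm_topology X N) euclidean (\<lambda>h. h w)"
    and "polynomials \<subseteq> X"
    and \<psi>: "\<And>h. h \<in> X \<Longrightarrow> \<psi> * h \<in> X"
    and cyc: "shift_cyclic X N \<phi>" "shift_cyclic X N \<psi>"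
  shows "shift_cyclic X N (\<psi> * \<phi>)"
proof -
  interpret X: banach_function_space X N by fact
  obtain K where K: "\<And>h. h \<in> X \<Longrightarrow> N (\<psi> * h) \<le> K * N h" "K > 0"
    using multiplication_bounded[OF X X ev ev \<psi>] by blast
  have cyc': "\<phi> \<in> X" "{p * \<phi> | p. p \<in> polynomials} \<subseteq> X" "{p * \<psi> | p. p \<in> polynomials} \<subseteq> X"
      "\<And>h e. h \<in> X \<Longrightarrow> e > 0 \<Longrightarrow> \<exists>p\<in>polynomials. N (p * \<phi> - h) < e"
      "\<And>h e. h \<in> X \<Longrightarrow> e > 0 \<Longrightarrow> \<exists>p\<in>polynomials. N (p * \<psi> - h) < e"
    using cyc unfolding shift_cyclic_def X.dense_subset_iff by blast+
  have mem: "p * (\<psi> * \<phi>) \<in> X" if "p \<in> polynomials" for p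
    using \<psi>[of "p * \<phi>"] cyc'(2) that by (auto simp: mult.left_commute)
  have "\<exists>p\<in>polynomials. N (p * (\<psi> * \<phi>) - h) < e" if h: "h \<in> X" "e > 0" for h e
  proof -
    obtain p where p: "p \<in> polynomials" "N (p * \<psi> - h) < e / 2"
      using cyc'(5)[OF h(1), of "e / 2"] h(2) by auto
    have "p \<in> X" using p assms(3) by auto
    then obtain r where r: "r \<in> polynomials" "N (r * \<phi> - p) < e / (2 * K)"
      using cyc'(4)[OF \<open>p \<in> X\<close>, of "e / (2 * K)"] h K(2) by auto
    have mems: "r * \<phi> \<in> X" "p * \<psi> \<in> X" "r * (\<psi> * \<phi>) \<in> X"
      using cyc'(2,3) p r mem by auto
    have "N (r * (\<psi> * \<phi>) - h) \<le> N (r * (\<psi> * \<phi>) - p * \<psi>) + N (p * \<psi> - h)"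
      by (intro X.norm_diff_triangle mems h)
    also have "r * (\<psi> * \<phi>) - p * \<psi> = \<psi> * (r * \<phi> - p)"
      by (simp add: algebra_simps)
    also have "N \<dots> \<le> K * N (r * \<phi> - p)"
      by (intro K X.diff_mem mems \<open>p \<in> X\<close>)
    also have "K * N (r * \<phi> - p) < e / 2"
      using r(2) K(2) by (simp add: field_simps)
    finally have "N (r * (\<psi> * \<phi>) - h) < e"
      using p(2) by linarith
    with r(1) show ?thesis by blast
  qed
  moreover have "\<psi> * \<phi> \<in> X" by (intro \<psi> cyc')
  ultimately show ?thesis
    unfolding shift_cyclic_def X.dense_subset_iff using mem by blast
qed

theorem corollary2:
  fixes X A :: "(complex \<Rightarrow> complex) set"
    and norm_X norm_A :: "(complex \<Rightarrow> complex) \<Rightarrow> real"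
    and f g :: "complex \<Rightarrow> complex"
  assumes "banach_function_space X norm_X"
    and "\<And>h. h \<in> X \<Longrightarrow> h analytic_on \<D>"
    and "\<And>w. w \<in> \<D> \<Longrightarrow> continuous_map (norm_topology X norm_X) euclidean (\<lambda>h. h w)"
    and "\<And>h. h \<in> X \<Longrightarrow> shift_operator h \<in> X"
    and "dense_subset X norm_X polynomials"
    and "banach_function_algebra A norm_A"
    and "A \<subseteq> multipliers X"
    and "\<And>w. w \<in> \<D> \<Longrightarrow> continuous_map (norm_topology A norm_A) euclidean (\<lambda>h. h w)"
    and "\<exists>C a :: real. C > 0 \<and> a \<ge> 1 \<and>
           (\<forall>\<delta>>0. \<forall>f1\<in>A. \<forall>f2\<in>A.
              (\<forall>z\<in>\<D>. \<delta> \<le> cmod (f1 z) + cmod (f2 z) \<and> cmod (f1 z) + cmod (f2 z) \<le> 1) \<longrightarrow>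
              (\<exists>g1\<in>A. \<exists>g2\<in>A. (\<forall>z\<in>\<D>. f1 z * g1 z + f2 z * g2 z = 1) \<and>
                 norm_A g1 \<le> C / \<delta> powr a \<and> norm_A g2 \<le> C / \<delta> powr a))"
    and "f \<in> A" and "g \<in> A"
    and "\<And>z. z \<in> \<D> \<Longrightarrow> cmod (g z) \<le> cmod (f z)"
    and "shift_cyclic X norm_X g"
  shows "shift_cyclic X norm_X f"
proof -
  interpret X: banach_function_space X norm_X by fact
  interpret A: banach_function_algebra A norm_A by fact
  have A_mult: "h * u \<in> X" "h \<in> X" if "h \<in> A" "u \<in> X" for h u
    using that assms(7) by (auto simp: multipliers_def)
  have poly: "polynomials \<subseteq> X" "\<And>h e. h \<in> X \<Longrightarrow> e > 0 \<Longrightarrow> \<exists>p\<in>polynomials. norm_X (p - h) < e"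
    using assms(5) unfolding X.dense_subset_iff by blast+
  obtain C a :: real where C: "C > 0" "\<forall>\<delta>>0. \<forall>f1\<in>A. \<forall>f2\<in>A.
      (\<forall>z\<in>\<D>. \<delta> \<le> cmod (f1 z) + cmod (f2 z) \<and> cmod (f1 z) + cmod (f2 z) \<le> 1) \<longrightarrow>
      (\<exists>g1\<in>A. \<exists>g2\<in>A. (\<forall>z\<in>\<D>. f1 z * g1 z + f2 z * g2 z = 1) \<and>
         norm_A g1 \<le> C / \<delta> powr a \<and> norm_A g2 \<le> C / \<delta> powr a)"
    using assms(9) by blast
  obtain m where m: "\<And>e. e > 0 \<Longrightarrow> \<exists>k\<in>A. norm_A (on_disc (g ^ m) - f * k) < e"
    using A.power_in_closure_ideal[OF assms(8) C assms(10,11,12)] by blast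
  \<comment> \<open>The base case, cyclicity of the unit, is the density of the polynomials.\<close>
  have power: "on_disc (g ^ n) \<in> A \<and> shift_cyclic X norm_X (on_disc (g ^ n))" for n
  proof (induction n)
    case 0
    have unit: "on_disc (g ^ 0) = on_disc (\<lambda>z. 1)"
      by (simp add: on_disc_def fun_eq_iff)
    have "p * on_disc (\<lambda>z. 1) = p" if "p \<in> polynomials" for p
      using that by (auto simp: polynomials_def on_disc_def fun_eq_iff)
    then have "{p * on_disc (\<lambda>z. 1) | p. p \<in> polynomials} = polynomials"
      by (force simp del: times_fun_apply)
    moreover have "on_disc (\<lambda>z. 1) \<in> X"
      using A_mult(2) A.unit_mem X.zero_mem by blast
    ultimately show ?case
      unfolding unit shift_cyclic_def using A.unit_mem assms(5) by simp
  next
    case (Suc n)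
    have "on_disc (g ^ Suc n) = g * on_disc (g ^ n)"
      using A.on_disc_mem[OF assms(11)] by (simp add: A.on_disc_ring)
    then show ?case
      using Suc shift_cyclic_mult[OF assms(1,3) poly(1) A_mult(1)[OF assms(11)] _ assms(13)]
        A.mult_mem[OF assms(11)] by (simp only: simp_thms)
  qed
  define G where "G = on_disc (g ^ m)"
  have G: "G \<in> A" "\<And>h e. h \<in> X \<Longrightarrow> e > 0 \<Longrightarrow> \<exists>p\<in>polynomials. norm_X (p * G - h) < e"
    using power[of m] unfolding G_def shift_cyclic_def X.dense_subset_iff by blast+
  obtain K where K: "\<And>h. h \<in> X \<Longrightarrow> norm_X (f * h) \<le> K * norm_X h" "K > 0"
    using multiplication_bounded[OF assms(1,1,3,3) A_mult(1)[OF assms(10)]] by blast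
  \<comment> \<open>Three approximations, each within e / 3: h by p G, then G by f k, then p k by a
    polynomial r.\<close>
  have "\<exists>p\<in>polynomials. norm_X (p * f - h) < e" if h: "h \<in> X" "e > 0" for h e
  proof -
    obtain p where p: "p \<in> polynomials" "norm_X (p * G - h) < e / 3"
      using G(2)[of h "e / 3"] h by auto
    then have "p \<in> X" using poly(1) by auto
    then have p_mult: "p * u \<in> X" if "u \<in> A" for u
      using A_mult(1)[OF that, of p] by (simp add: mult.commute)
    \<comment> \<open>J depends on p, so p is fixed before the accuracy of k is chosen.\<close>
    obtain J where J: "\<And>u. u \<in> A \<Longrightarrow> norm_X (p * u) \<le> J * norm_A u" "J > 0"
      using multiplication_bounded[OF A.banach_function_space_axioms assms(1,8,3) p_mult] by blast
    obtain k where k: "k \<in> A" "norm_A (G - f * k) < e / (3 * J)"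
      using m[of "e / (3 * J)"] h J(2) by (auto simp: G_def)
    obtain r where r: "r \<in> polynomials" "norm_X (r - p * k) < e / (3 * K)"
      using poly(2)[OF p_mult[OF k(1)], of "e / (3 * K)"] h K(2) by auto
    have "r \<in> X" using r poly(1) by auto
    have fr: "r * f \<in> X" and fkp: "f * (p * k) \<in> X"
      using A_mult(1)[OF assms(10) \<open>r \<in> X\<close>] A_mult(1)[OF assms(10) p_mult[OF k(1)]]
      by (simp_all only: mult.commute[of r])
    have "norm_X (r * f - h) \<le> norm_X (r * f - f * (p * k)) + norm_X (f * (p * k) - h)"
      by (intro X.norm_diff_triangle fr fkp h)
    also have "norm_X (f * (p * k) - h) \<le> norm_X (f * (p * k) - p * G) + norm_X (p * G - h)"
      by (intro X.norm_diff_triangle fkp p_mult G h)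
    also have "norm_X (r * f - f * (p * k)) < e / 3"
    proof -
      have "r * f - f * (p * k) = f * (r - p * k)"
        by (simp add: algebra_simps)
      then show ?thesis
        using K(1)[OF X.diff_mem[OF \<open>r \<in> X\<close> p_mult[OF k(1)]]] r(2) K(2) by (simp add: field_simps)
    qed
    also have "norm_X (f * (p * k) - p * G) < e / 3"
    proof -
      have fk: "G - f * k \<in> A"
        by (intro A.diff_mem A.mult_mem G k assms)
      have "norm_X (f * (p * k) - p * G) = norm_X (p * G - f * (p * k))"
        by (intro X.norm_diff_commute fkp p_mult G)
      also have "p * G - f * (p * k) = p * (G - f * k)"
        by (simp add: algebra_simps)
      finally have "norm_X (f * (p * k) - p * G) \<le> J * norm_A (G - f * k)"
        using J(1)[OF fk] by (rule ord_eq_le_trans)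
      also have "\<dots> < e / 3"
        using k(2) J(2) by (simp add: field_simps)
      finally show ?thesis .
    qed
    finally have "norm_X (r * f - h) < e"
      using p(2) by linarith
    with r(1) show ?thesis by blast
  qed
  moreover have "p * f \<in> X" if "p \<in> polynomials" for p
    using A_mult(1)[OF assms(10), of p] poly(1) that by (simp only: mult.commute[of p] subset_iff)
  moreover have "f \<in> X"
    using A_mult(2) assms(10) X.zero_mem by blast
  ultimately show ?thesis
    unfolding shift_cyclic_def X.dense_subset_iff by blast
qed

end
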